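(* Let $M$ be a matroid on ground set $[n]$ with rank function $\operatorname{rank}:2^{[n]}\to\mathbb{Z}_{\geqslant0}$, let $0<q\leqslant 1$, let $\boldsymbol\lambda=(\lambda_1,\dots,\lambda_n)\in\mathbb{R}_{>0}^n$ and let $k$ be a nonnegative integer. Then the polynomial \[ f_{M,k,q}(x_1,\dots,x_n)=\sum_{S\in\binom{[n]}{k}} q^{-\operatorname{rank}(S)}\prod_{i\in S}\lambda_i x_i\] is strongly log-concave at $\mathbb{1}$.
   Context: $\operatorname{rank}(S)$ is the size of a largest independent set of $M$ contained in $S$; $\binom{[n]}{k}$ is the set of $k$-element subsets of $[n]$. A polynomial $p$ with nonnegative coefficients is log-concave at $\mathbb{1}=(1,\dots,1)$ if it is identically zero or the Hessian of $\log p$ at $\mathbb{1}$ is negative semidefinite; it is strongly log-concave at $\mathbb{1}$ if for every $m\geqslant0$ and all $1\leqslant i_1,\dots,i_m\leqslant n$ (repetitions allowed), $\partial_{i_1}\cdots\partial_{i_m}p$ is log-concave at $\mathbb{1}$. *)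

theory Defs
  imports "HOL-Analysis.Analysis" "HOL-Library.Poly_Mapping"
begin

locale matroid =
  fixes E :: "'a set" and indep :: "'a set \<Rightarrow> bool"
  assumes finite_ground: "finite E"
    and indep_subset_ground: "indep X \<Longrightarrow> X \<subseteq> E"
    and indep_empty: "indep {}"
    and indep_mono: "indep X \<Longrightarrow> Y \<subseteq> X \<Longrightarrow> indep Y"
    and indep_augment:
      "indep X \<Longrightarrow> indep Y \<Longrightarrow> card X < card Y \<Longrightarrow> \<exists>y\<in>Y - X. indep (insert y X)"

definition matroid_rank :: "('a set \<Rightarrow> bool) \<Rightarrow> 'a set \<Rightarrow> nat" where
  "matroid_rank indep S = Max (card ` {X. X \<subseteq> S \<and> indep X})"

text \<open>
  Real multivariate polynomials are finitely supported maps from monomials (exponent vectors) to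
  coefficients; multiplication in this type is convolution. Variables are indexed by natural
  numbers, and a polynomial in \<open>n\<close> variables uses the indices \<open>1, \<dots>, n\<close>.
\<close>

type_synonym real_mpoly = "(nat \<Rightarrow>\<^sub>0 nat) \<Rightarrow>\<^sub>0 real"

definition mp_const :: "real \<Rightarrow> real_mpoly" where
  "mp_const c = Poly_Mapping.single 0 c"

definition mp_var :: "nat \<Rightarrow> real_mpoly" where
  "mp_var i = Poly_Mapping.single (Poly_Mapping.single i 1) 1"

definition mp_eval :: "real_mpoly \<Rightarrow> (nat \<Rightarrow> real) \<Rightarrow> real" where
  "mp_eval p x =
     (\<Sum>m\<in>Poly_Mapping.keys p. Poly_Mapping.lookup p m *
        (\<Prod>i\<in>Poly_Mapping.keys m. x i ^ Poly_Mapping.lookup m i))"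

text \<open>
  Formal partial derivative. The subtraction of exponents is truncated, but where it truncates the
  coefficient is zero.
\<close>

definition mp_deriv :: "nat \<Rightarrow> real_mpoly \<Rightarrow> real_mpoly" where
  "mp_deriv i p =
     (\<Sum>m\<in>Poly_Mapping.keys p.
        Poly_Mapping.single (m - Poly_Mapping.single i 1)
          (real (Poly_Mapping.lookup m i) * Poly_Mapping.lookup p m))"

definition partial_deriv :: "nat \<Rightarrow> ((nat \<Rightarrow> real) \<Rightarrow> real) \<Rightarrow> (nat \<Rightarrow> real) \<Rightarrow> real" where
  "partial_deriv i g x = deriv (\<lambda>t. g (x(i := t))) (x i)"

definition hessian :: "((nat \<Rightarrow> real) \<Rightarrow> real) \<Rightarrow> (nat \<Rightarrow> real) \<Rightarrow> nat \<Rightarrow> nat \<Rightarrow> real" where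
  "hessian g x i j = partial_deriv i (partial_deriv j g) x"

definition neg_semidef :: "nat \<Rightarrow> (nat \<Rightarrow> nat \<Rightarrow> real) \<Rightarrow> bool" where
  "neg_semidef n H \<longleftrightarrow>
     (\<forall>i\<in>{1..n}. \<forall>j\<in>{1..n}. H i j = H j i) \<and>
     (\<forall>v :: nat \<Rightarrow> real. (\<Sum>i\<in>{1..n}. \<Sum>j\<in>{1..n}. v i * H i j * v j) \<le> 0)"

text \<open>
  A nonzero polynomial with nonnegative coefficients is positive near \<open>(1, \<dots>, 1)\<close>, so its
  logarithm is smooth there and the derivatives below are genuine.
\<close>

definition log_concave_at_one :: "nat \<Rightarrow> real_mpoly \<Rightarrow> bool" where
  "log_concave_at_one n p \<longleftrightarrow>
     (\<forall>m. 0 \<le> Poly_Mapping.lookup p m) \<and>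
     (p = 0 \<or> neg_semidef n (hessian (\<lambda>x. ln (mp_eval p x)) (\<lambda>_. 1)))"

definition strongly_log_concave_at_one :: "nat \<Rightarrow> real_mpoly \<Rightarrow> bool" where
  "strongly_log_concave_at_one n p \<longleftrightarrow>
     (\<forall>is. set is \<subseteq> {1..n} \<longrightarrow> log_concave_at_one n (foldr mp_deriv is p))"

definition rank_poly ::
    "nat \<Rightarrow> (nat set \<Rightarrow> bool) \<Rightarrow> nat \<Rightarrow> real \<Rightarrow> (nat \<Rightarrow> real) \<Rightarrow> real_mpoly" where
  "rank_poly n indep k q lam =
     (\<Sum>S\<in>{S. S \<subseteq> {1..n} \<and> card S = k}.
        mp_const (q powi (- int (matroid_rank indep S))) *
        (\<Prod>i\<in>S. mp_const (lam i) * mp_var i))"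

end

theory Submission imports Defs begin

text \<open>
  All partial derivatives of \<open>f\<^bsub>M,k,q\<^esub>\<close> are multiaffine, and the value at \<open>\<one>\<close> of the derivative along
  a set \<open>T\<close> is \<open>h T\<close>, the total weight of the \<open>k\<close>-sets containing \<open>T\<close>. So log-concavity follows (by
  Euler's identity) once the matrices \<open>h (T + i + j)\<close> are shown to be Lorentzian: \<open>Q(v) Q(\<one>) \<le> B(v, \<one>)\<^sup>2\<close>.
  For \<open>|T| = k - 2\<close> the matrix is, up to diagonal rescaling, the all-ones matrix minus a positive
  semidefinite one that is read off from the loops and parallel classes of \<open>M/T\<close>; here \<open>q \<le> 1\<close> is used.
  Smaller \<open>T\<close> are reached by descending induction: by Euler's identity the matrix of \<open>T\<close> is the
  average of those of the sets \<open>T + l\<close>, and summing their Lorentzian inequalities shows that the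
  associated random walk has no eigenvalue strictly between 0 and 1.
\<close>

section \<open>Lorentzian quadratic forms and the trickle-down argument\<close>

text \<open>A reverse Cauchy-Schwarz inequality against the all-ones vector only. For symmetric
  \<open>H\<close> with positive total it says that \<open>H\<close> has exactly one positive
  eigenvalue.\<close>

definition lorentzian_on :: "'a set \<Rightarrow> ('a \<Rightarrow> 'a \<Rightarrow> real) \<Rightarrow> bool" where
  "lorentzian_on A H \<longleftrightarrow>
     (\<forall>v. (\<Sum>i\<in>A. \<Sum>j\<in>A. v i * H i j * v j) * (\<Sum>i\<in>A. \<Sum>j\<in>A. H i j) \<le> (\<Sum>i\<in>A. \<Sum>j\<in>A. v i * H i j)\<^sup>2)"

lemma linear_coeff_zero_if_nonpos:
  fixes a b :: real
  assumes "\<And>t. a * t + b * t\<^sup>2 \<le> 0"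
  shows "a = 0"
proof (rule ccontr)
  assume a: "a \<noteq> 0"
  \<comment> \<open>With this choice the linear term \<open>a * t\<close> equals
    \<open>t\<^sup>2 * (|b| + 1)\<close>, which outweighs \<open>b * t\<^sup>2\<close>.\<close>
  define t where "t = a / (\<bar>b\<bar> + 1)"
  have at: "a = t * (\<bar>b\<bar> + 1)" and t0: "t \<noteq> 0"
    using a by (auto simp: t_def)
  have "a * t + b * t\<^sup>2 = t\<^sup>2 * (\<bar>b\<bar> + 1 + b)"
    by (simp add: at power2_eq_square algebra_simps)
  moreover have "t\<^sup>2 * (\<bar>b\<bar> + 1 + b) > 0"
    using t0 by (intro mult_pos_pos) auto
  ultimately show False using assms[of t] by linarith
qed

text \<open>Completing the square after multiplication by \<open>a\<close>, which also covers
  \<open>a = 0\<close>.\<close>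

lemma discriminant_nonneg:
  fixes a b c t :: real
  assumes "a * t\<^sup>2 - 2 * b * t + c \<le> 0" "0 \<le> a"
  shows "c * a \<le> b\<^sup>2"
proof -
  have "(a * t - b)\<^sup>2 = a * (a * t\<^sup>2 - 2 * b * t + c) + b\<^sup>2 - c * a"
    by (simp add: power2_eq_square algebra_simps)
  moreover have "a * (a * t\<^sup>2 - 2 * b * t + c) \<le> 0"
    using assms by (simp add: mult_nonneg_nonpos)
  moreover have "0 \<le> (a * t - b)\<^sup>2" by simp
  ultimately show ?thesis by linarith
qed

lemma quadratic_shift:
  fixes H :: "'a \<Rightarrow> 'a \<Rightarrow> real"
  assumes sym: "\<And>i j. i \<in> A \<Longrightarrow> j \<in> A \<Longrightarrow> H i j = H j i"
  shows "(\<Sum>i\<in>A. \<Sum>j\<in>A. (v i + t * w i) * H i j * (v j + t * w j)) =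
     (\<Sum>i\<in>A. \<Sum>j\<in>A. v i * H i j * v j) + 2 * t * (\<Sum>i\<in>A. \<Sum>j\<in>A. v i * H i j * w j)
      + t\<^sup>2 * (\<Sum>i\<in>A. \<Sum>j\<in>A. w i * H i j * w j)"
proof -
  have "(\<Sum>i\<in>A. \<Sum>j\<in>A. w i * H i j * v j) = (\<Sum>j\<in>A. \<Sum>i\<in>A. w i * H i j * v j)"
    by (rule sum.swap)
  also have "\<dots> = (\<Sum>i\<in>A. \<Sum>j\<in>A. v i * H i j * w j)"
    by (intro sum.cong refl) (simp add: sym mult_ac)
  finally have *: "(\<Sum>i\<in>A. \<Sum>j\<in>A. w i * H i j * v j) = (\<Sum>i\<in>A. \<Sum>j\<in>A. v i * H i j * w j)" .
  have "(\<Sum>i\<in>A. \<Sum>j\<in>A. (v i + t * w i) * H i j * (v j + t * w j)) =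
     (\<Sum>i\<in>A. \<Sum>j\<in>A. v i * H i j * v j + t * (v i * H i j * w j) + t * (w i * H i j * v j)
        + t\<^sup>2 * (w i * H i j * w j))"
    by (intro sum.cong refl) (simp add: algebra_simps power2_eq_square)
  also have "\<dots> = (\<Sum>i\<in>A. \<Sum>j\<in>A. v i * H i j * v j) + t * (\<Sum>i\<in>A. \<Sum>j\<in>A. v i * H i j * w j)
      + t * (\<Sum>i\<in>A. \<Sum>j\<in>A. w i * H i j * v j) + t\<^sup>2 * (\<Sum>i\<in>A. \<Sum>j\<in>A. w i * H i j * w j)"
    by (simp add: sum.distrib sum_distrib_left)
  finally show ?thesis using * by simp
qed

text \<open>Along the line \<open>v + t\<close> the form is a quadratic in \<open>t\<close> whose
  leading coefficient is the total of \<open>H\<close>. One nonpositive value forces its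
  discriminant to be nonnegative, and that is the Lorentzian inequality.\<close>

lemma lorentzian_onI:
  fixes H :: "'a \<Rightarrow> 'a \<Rightarrow> real"
  assumes sym: "\<And>i j. i \<in> A \<Longrightarrow> j \<in> A \<Longrightarrow> H i j = H j i"
    and nonneg: "0 \<le> (\<Sum>i\<in>A. \<Sum>j\<in>A. H i j)"
    and shift: "\<And>v. \<exists>t. (\<Sum>i\<in>A. \<Sum>j\<in>A. (v i + t) * H i j * (v j + t)) \<le> 0"
  shows "lorentzian_on A H"
  unfolding lorentzian_on_def
proof
  fix v
  obtain t where "(\<Sum>i\<in>A. \<Sum>j\<in>A. (v i + t) * H i j * (v j + t)) \<le> 0"
    using shift by blast
  then have "(\<Sum>i\<in>A. \<Sum>j\<in>A. v i * H i j * v j) + 2 * t * (\<Sum>i\<in>A. \<Sum>j\<in>A. v i * H i j)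
      + t\<^sup>2 * (\<Sum>i\<in>A. \<Sum>j\<in>A. H i j) \<le> 0"
    using quadratic_shift[of A H v t "\<lambda>_. 1"] sym by simp
  then show "(\<Sum>i\<in>A. \<Sum>j\<in>A. v i * H i j * v j) * (\<Sum>i\<in>A. \<Sum>j\<in>A. H i j)
      \<le> (\<Sum>i\<in>A. \<Sum>j\<in>A. v i * H i j)\<^sup>2"
    using nonneg
    by (intro discriminant_nonneg[where t = "- t"]) (simp_all add: algebra_simps)
qed

text \<open>Serves to pad the form belonging to \<open>insert l T\<close> by a zero row and column
  at \<open>l\<close>, so that all these forms live on the same index set.\<close>

lemma lorentzian_on_superset:
  assumes "finite A" "V \<subseteq> A"
    and "\<And>i j. i \<in> A \<Longrightarrow> j \<in> A \<Longrightarrow> i \<notin> V \<or> j \<notin> V \<Longrightarrow> H i j = 0"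
  shows "lorentzian_on A H \<longleftrightarrow> lorentzian_on V H"
proof -
  have "(\<Sum>i\<in>A. \<Sum>j\<in>A. f i j) = (\<Sum>i\<in>V. \<Sum>j\<in>V. f i j)"
    if "\<And>i j. i \<in> A \<Longrightarrow> j \<in> A \<Longrightarrow> i \<notin> V \<or> j \<notin> V \<Longrightarrow> f i j = 0" for f :: "'a \<Rightarrow> 'a \<Rightarrow> real"
  proof -
    have "(\<Sum>i\<in>A. \<Sum>j\<in>A. f i j) = (\<Sum>i\<in>V. \<Sum>j\<in>A. f i j)"
      using assms(1,2) that by (intro sum.mono_neutral_right) (auto intro!: sum.neutral)
    also have "\<dots> = (\<Sum>i\<in>V. \<Sum>j\<in>V. f i j)"
      using assms(1,2) that by (intro sum.cong refl sum.mono_neutral_right) auto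
    finally show ?thesis .
  qed
  then show ?thesis
    unfolding lorentzian_on_def using assms(3) by simp
qed

section \<open>Extremal vectors and the spectral gap\<close>

text \<open>Compactness of the unit sphere, followed by scaling. Vectors are functions on the whole
  type, so the sphere is cut with a product of compact intervals, which is compact by Tychonoff's
  theorem.\<close>

lemma rayleigh_quotient_attains_max:
  fixes D :: "'a \<Rightarrow> real" and H :: "'a \<Rightarrow> 'a \<Rightarrow> real"
  assumes fin: "finite V" and D: "\<And>i. i \<in> V \<Longrightarrow> 0 < D i"
    and u: "(\<Sum>i\<in>V. D i * u i) = 0" "0 < (\<Sum>i\<in>V. D i * (u i)\<^sup>2)"
  obtains v where "(\<Sum>i\<in>V. D i * v i) = 0" "(\<Sum>i\<in>V. D i * (v i)\<^sup>2) = 1"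
    "\<And>w. (\<Sum>i\<in>V. D i * w i) = 0 \<Longrightarrow>
       (\<Sum>i\<in>V. \<Sum>j\<in>V. w i * H i j * w j)
         \<le> (\<Sum>i\<in>V. \<Sum>j\<in>V. v i * H i j * v j) * (\<Sum>i\<in>V. D i * (w i)\<^sup>2)"
proof -
  let ?Q = "\<lambda>v. \<Sum>i\<in>V. \<Sum>j\<in>V. v i * H i j * v j"
  let ?N = "\<lambda>v. \<Sum>i\<in>V. D i * (v i)\<^sup>2"
  let ?L = "\<lambda>v. \<Sum>i\<in>V. D i * v i"
  \<comment> \<open>\<open>?N v = 1\<close> forces \<open>D i * (v i)\<^sup>2 \<le> 1\<close> on
    \<open>V\<close>; outside \<open>V\<close> the interval shrinks to \<open>{0}\<close>.\<close>
  define b where "b i = (if i \<in> V then sqrt (1 / D i) else 0)" for i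
  define box where "box = PiE (UNIV :: 'a set) (\<lambda>i. {- b i..b i})"
  define K where "K = {v. ?L v = 0 \<and> ?N v = 1} \<inter> box"
  have cont: "continuous_on UNIV ?Q" "continuous_on UNIV ?N" "continuous_on UNIV ?L"
    by (intro continuous_intros continuous_on_product_coordinates)+
  have "compact box"
    unfolding box_def
    using compactin_PiE[of "\<lambda>_. euclidean" "UNIV :: 'a set" "\<lambda>i. {- b i..b i}"]
    by (simp add: euclidean_product_topology)
  moreover have "closed {v. ?L v = 0 \<and> ?N v = 1}"
    by (intro closed_Collect_conj closed_Collect_eq cont continuous_on_const)
  ultimately have K: "compact K"
    unfolding K_def by (simp add: closed_Int_compact)
  \<comment> \<open>Values outside \<open>V\<close> do not enter the sums; setting them to zero
    places the normalised vector in \<open>box\<close>.\<close>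
  define nrm where "nrm w i = (if i \<in> V then w i / sqrt (?N w) else 0)" for w i
  have nrm: "nrm w \<in> K" "?Q w = ?Q (nrm w) * ?N w" if L: "?L w = 0" and N: "0 < ?N w" for w
  proof -
    have "?L (nrm w) = ?L w / sqrt (?N w)"
      unfolding sum_divide_distrib by (intro sum.cong) (auto simp: nrm_def)
    then have 1: "?L (nrm w) = 0" using L by simp
    have "?N (nrm w) = ?N w / ?N w"
      unfolding sum_divide_distrib[of _ _ "?N w"] using N
      by (intro sum.cong refl) (simp add: nrm_def power_divide)
    then have 2: "?N (nrm w) = 1" using N by simp
    have "nrm w i \<in> {- b i..b i}" for i
    proof (cases "i \<in> V")
      case True
      have "D i * (nrm w i)\<^sup>2 \<le> ?N (nrm w)"
        using D True fin by (intro member_le_sum) (auto simp: less_imp_le)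
      then have "(nrm w i)\<^sup>2 \<le> 1 / D i"
        using 2 D[OF True] by (simp add: field_simps)
      then have "\<bar>nrm w i\<bar> \<le> b i"
        using True real_le_rsqrt[of "\<bar>nrm w i\<bar>"] by (simp add: b_def)
      then show ?thesis by auto
    qed (simp add: nrm_def b_def)
    with 1 2 show "nrm w \<in> K" by (auto simp: K_def box_def PiE_UNIV_domain)
    have "?Q (nrm w) * ?N w = (\<Sum>i\<in>V. \<Sum>j\<in>V. nrm w i * H i j * nrm w j * ?N w)"
      by (simp only: sum_distrib_right)
    also have "\<dots> = ?Q w"
    proof (intro sum.cong refl)
      fix i j assume ij: "i \<in> V" "j \<in> V"
      have "sqrt (?N w) * sqrt (?N w) = ?N w" "sqrt (?N w) \<noteq> 0" using N by auto
      then show "nrm w i * H i j * nrm w j * ?N w = w i * H i j * w j"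
        using ij by (simp add: nrm_def field_simps)
    qed
    finally show "?Q w = ?Q (nrm w) * ?N w" by simp
  qed
  have "K \<noteq> {}" using nrm(1) u by blast
  then obtain v where v: "v \<in> K" "\<And>w. w \<in> K \<Longrightarrow> ?Q w \<le> ?Q v"
    using continuous_attains_sup[OF K _ continuous_on_subset[OF cont(1) subset_UNIV]] by blast
  show ?thesis
  proof (rule that)
    show "?L v = 0" "?N v = 1" using v(1) by (simp_all add: K_def)
    fix w assume L: "?L w = 0"
    show "?Q w \<le> ?Q v * ?N w"
    proof (cases "0 < ?N w")
      case True
      then show ?thesis using nrm[OF L True] v(2) by (simp add: mult_right_mono)
    next
      case False
      moreover have nn: "0 \<le> D i * (w i)\<^sup>2" if "i \<in> V" for i using D[OF that] by simp
      moreover have "0 \<le> ?N w" by (rule sum_nonneg) (rule nn)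
      ultimately have "?N w = 0" by linarith
      then have "D i * (w i)\<^sup>2 = 0" if "i \<in> V" for i
        using sum_nonneg_eq_0_iff[OF fin nn] that by auto
      then have "w i = 0" if "i \<in> V" for i using D that by fastforce
      then show ?thesis by simp
    qed
  qed
qed

text \<open>
  The hypothesis \<open>gap\<close> says that \<open>D\<^sup>-\<^sup>1 H\<close> has no eigenvalue in \<open>(0, 1)\<close>; being an irreducible
  stochastic matrix, it has \<open>1\<close> as a simple largest eigenvalue, so all others are nonpositive.
\<close>

lemma nonpos_on_complement_if_spectral_gap:
  fixes H :: "'a \<Rightarrow> 'a \<Rightarrow> real"
  assumes fin: "finite V"
    and sym: "\<And>i j. i \<in> V \<Longrightarrow> j \<in> V \<Longrightarrow> H i j = H j i"
    and nonneg: "\<And>i j. i \<in> V \<Longrightarrow> j \<in> V \<Longrightarrow> 0 \<le> H i j"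
    and pos: "\<And>i j. i \<in> V \<Longrightarrow> j \<in> V \<Longrightarrow> i \<noteq> j \<Longrightarrow> 0 < H i j"
    and D_def: "\<And>i. i \<in> V \<Longrightarrow> D i = (\<Sum>j\<in>V. H i j)"
    and D: "\<And>i. i \<in> V \<Longrightarrow> 0 < D i"
    and gap: "\<And>v. (\<Sum>i\<in>V. \<Sum>j\<in>V. v i * H i j * v j) \<le> (\<Sum>i\<in>V. (\<Sum>j\<in>V. H i j * v j)\<^sup>2 / D i)"
    and u: "(\<Sum>i\<in>V. D i * u i) = 0"
  shows "(\<Sum>i\<in>V. \<Sum>j\<in>V. u i * H i j * u j) \<le> 0"
proof (rule ccontr)
  let ?Q = "\<lambda>v. \<Sum>i\<in>V. \<Sum>j\<in>V. v i * H i j * v j"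
  let ?N = "\<lambda>v. \<Sum>i\<in>V. D i * (v i)\<^sup>2"
  let ?L = "\<lambda>v. \<Sum>i\<in>V. D i * v i"
  assume "\<not> ?thesis"
  then have Qu: "0 < ?Q u" by simp
  have N_nonneg: "0 \<le> ?N w" for w
    using D by (intro sum_nonneg) (auto simp: less_imp_le)
  have "?N u \<noteq> 0"
  proof
    assume "?N u = 0"
    moreover have "0 \<le> D i * (u i)\<^sup>2" if "i \<in> V" for i using D[OF that] by simp
    ultimately have "D i * (u i)\<^sup>2 = 0" if "i \<in> V" for i
      using sum_nonneg_eq_0_iff[OF fin, of "\<lambda>i. D i * (u i)\<^sup>2"] that by auto
    then have "u i = 0" if "i \<in> V" for i using D that by fastforce
    then show False using Qu by simp
  qed
  then have "0 < ?N u" using N_nonneg[of u] by linarith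
  then obtain v where Lv: "?L v = 0" and Nv: "?N v = 1"
    and max: "\<And>w. ?L w = 0 \<Longrightarrow> ?Q w \<le> ?Q v * ?N w"
    using rayleigh_quotient_attains_max[OF fin D u, of H] by blast
  define \<mu> where "\<mu> = ?Q v"
  have "0 < \<mu> * ?N u" using max[OF u] Qu by (simp add: \<mu>_def)
  then have mu_pos: "0 < \<mu>" using N_nonneg[of u] by (simp add: zero_less_mult_iff)
  define Hv where "Hv i = (\<Sum>j\<in>V. H i j * v j)" for i
  \<comment> \<open>The defect of \<open>v\<close> as an eigenvector of
    \<open>D\<^sup>-\<^sup>1 H\<close> for \<mu>. It satisfies the same linear constraint as
    \<open>v\<close>, so it is an admissible direction of variation.\<close>
  define w where "w i = Hv i / D i - \<mu> * v i" for i
  have Dw: "D i * w i = Hv i - \<mu> * (D i * v i)" if "i \<in> V" for i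
    using D[OF that] by (simp add: w_def field_simps)
  have sum_Hv: "(\<Sum>i\<in>V. Hv i) = 0"
  proof -
    have "(\<Sum>i\<in>V. Hv i) = (\<Sum>j\<in>V. \<Sum>i\<in>V. H i j * v j)"
      unfolding Hv_def by (rule sum.swap)
    also have "\<dots> = (\<Sum>j\<in>V. D j * v j)"
      by (intro sum.cong refl) (simp add: D_def sum_distrib_right sym)
    finally show ?thesis using Lv by simp
  qed
  have Lw: "?L w = 0"
    using sum_Hv Lv by (simp add: Dw sum_subtractf flip: sum_distrib_left)
  have B: "(\<Sum>i\<in>V. \<Sum>j\<in>V. v i * H i j * x j) = (\<Sum>i\<in>V. x i * Hv i)" for x
  proof -
    have "(\<Sum>i\<in>V. \<Sum>j\<in>V. v i * H i j * x j) = (\<Sum>j\<in>V. \<Sum>i\<in>V. v i * H i j * x j)"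
      by (rule sum.swap)
    also have "\<dots> = (\<Sum>i\<in>V. x i * Hv i)"
      unfolding Hv_def by (intro sum.cong refl) (simp add: sum_distrib_left sym mult_ac)
    finally show ?thesis .
  qed
  \<comment> \<open>Maximality along \<open>v + t * w\<close> kills the linear term in
    \<open>t\<close>. That term turns out to be \<open>2 * ?N w\<close>, so \<open>w\<close>
    vanishes on \<open>V\<close> and \<open>v\<close> is an eigenvector.\<close>
  have "2 * ((\<Sum>i\<in>V. w i * Hv i) - \<mu> * (\<Sum>i\<in>V. D i * v i * w i)) = 0"
  proof (rule linear_coeff_zero_if_nonpos)
    fix t
    have "?L (\<lambda>i. v i + t * w i) = ?L v + t * ?L w"
      by (simp add: sum.distrib sum_distrib_left algebra_simps)
    then have "?Q (\<lambda>i. v i + t * w i) \<le> \<mu> * ?N (\<lambda>i. v i + t * w i)"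
      using max Lv Lw by (simp add: \<mu>_def)
    moreover have "?N (\<lambda>i. v i + t * w i) = ?N v + 2 * t * (\<Sum>i\<in>V. D i * v i * w i) + t\<^sup>2 * ?N w"
      by (simp add: sum.distrib sum_distrib_left algebra_simps power2_eq_square)
    moreover have "?Q (\<lambda>i. v i + t * w i) = \<mu> + 2 * t * (\<Sum>i\<in>V. w i * Hv i) + t\<^sup>2 * ?Q w"
      using quadratic_shift[of V H v t w] sym by (simp add: B \<mu>_def)
    ultimately show "2 * ((\<Sum>i\<in>V. w i * Hv i) - \<mu> * (\<Sum>i\<in>V. D i * v i * w i)) * t
        + (?Q w - \<mu> * ?N w) * t\<^sup>2 \<le> 0"
      using Nv by (simp add: algebra_simps)
  qed
  moreover have "(\<Sum>i\<in>V. w i * Hv i) - \<mu> * (\<Sum>i\<in>V. D i * v i * w i) = ?N w"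
    unfolding sum_distrib_left sum_subtractf[symmetric]
  proof (intro sum.cong refl)
    fix i assume i: "i \<in> V"
    have "w i * Hv i - \<mu> * (D i * v i * w i) = w i * (Hv i - \<mu> * (D i * v i))"
      by (simp add: algebra_simps)
    also have "\<dots> = D i * (w i)\<^sup>2" using Dw[OF i] by (simp add: power2_eq_square mult_ac)
    finally show "w i * Hv i - \<mu> * (D i * v i * w i) = D i * (w i)\<^sup>2" .
  qed
  ultimately have "?N w = 0" by simp
  moreover have "0 \<le> D i * (w i)\<^sup>2" if "i \<in> V" for i using D[OF that] by simp
  ultimately have "D i * (w i)\<^sup>2 = 0" if "i \<in> V" for i
    using sum_nonneg_eq_0_iff[OF fin, of "\<lambda>i. D i * (w i)\<^sup>2"] that by auto
  then have "w i = 0" if "i \<in> V" for i using D that by fastforce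
  then have eig: "Hv i = \<mu> * (D i * v i)" if "i \<in> V" for i using Dw[OF that] that by simp
  \<comment> \<open>For an eigenvector \<open>gap\<close> reads
    \<open>\<mu> \<le> \<mu>\<^sup>2\<close>, and \<mu> is positive.\<close>
  have "\<mu> \<le> (\<Sum>i\<in>V. (Hv i)\<^sup>2 / D i)"
    using gap[of v] by (simp add: \<mu>_def Hv_def)
  also have "\<dots> = (\<Sum>i\<in>V. \<mu>\<^sup>2 * (D i * (v i)\<^sup>2))"
    using D by (intro sum.cong refl) (simp add: eig power2_eq_square field_simps)
  also have "\<dots> = \<mu>\<^sup>2" using Nv by (simp flip: sum_distrib_left)
  finally have "1 \<le> \<mu>" using mu_pos by (simp add: power2_eq_square)
  \<comment> \<open>The Dirichlet form of \<open>v\<close> equals \<open>2 * (?N v - ?Q v)\<close>,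
    because the row and column sums of \<open>H\<close> are \<open>D\<close>. As \<mu> is at least 1
    it is not positive, so \<open>v\<close> is constant on \<open>V\<close>; then
    \<open>?L v = 0\<close> makes it zero, against \<open>?N v = 1\<close>.\<close>
  have "(\<Sum>i\<in>V. \<Sum>j\<in>V. H i j * (v i - v j)\<^sup>2) =
      (\<Sum>i\<in>V. \<Sum>j\<in>V. H i j * (v i)\<^sup>2) + (\<Sum>i\<in>V. \<Sum>j\<in>V. H i j * (v j)\<^sup>2) - 2 * ?Q v"
    by (simp add: sum.distrib sum_subtractf sum_distrib_left algebra_simps power2_eq_square)
  also have "(\<Sum>i\<in>V. \<Sum>j\<in>V. H i j * (v j)\<^sup>2) = (\<Sum>j\<in>V. \<Sum>i\<in>V. H i j * (v j)\<^sup>2)"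
    by (rule sum.swap)
  also have "\<dots> = ?N v"
    by (intro sum.cong refl) (simp add: D_def sum_distrib_right sym)
  also have "(\<Sum>i\<in>V. \<Sum>j\<in>V. H i j * (v i)\<^sup>2) = ?N v"
    by (intro sum.cong refl) (simp add: D_def sum_distrib_right)
  finally have "(\<Sum>i\<in>V. \<Sum>j\<in>V. H i j * (v i - v j)\<^sup>2) = 2 - 2 * \<mu>"
    using Nv by (simp add: \<mu>_def)
  then have dir: "(\<Sum>i\<in>V. \<Sum>j\<in>V. H i j * (v i - v j)\<^sup>2) \<le> 0" using \<open>1 \<le> \<mu>\<close> by simp
  have eq: "v i = v j" if ij: "i \<in> V" "j \<in> V" for i j
  proof (rule ccontr)
    assume ne: "v i \<noteq> v j"
    then have "0 < H i j * (v i - v j)\<^sup>2" using pos[OF ij] by fastforce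
    also have "\<dots> \<le> (\<Sum>j\<in>V. H i j * (v i - v j)\<^sup>2)"
      using fin ij nonneg by (intro member_le_sum[where f = "\<lambda>j. H i j * (v i - v j)\<^sup>2"]) auto
    also have "\<dots> \<le> (\<Sum>i\<in>V. \<Sum>j\<in>V. H i j * (v i - v j)\<^sup>2)"
      using fin ij nonneg
      by (intro member_le_sum[where f = "\<lambda>i. \<Sum>j\<in>V. H i j * (v i - v j)\<^sup>2"]) (auto intro!: sum_nonneg)
    finally show False using dir by simp
  qed
  have "V \<noteq> {}" using Nv by auto
  then obtain i0 where i0: "i0 \<in> V" by blast
  have "?L v = (\<Sum>i\<in>V. D i) * v i0"
    unfolding sum_distrib_right by (intro sum.cong refl) (metis eq i0)
  moreover have "0 < (\<Sum>i\<in>V. D i)" using fin D i0 by (intro sum_pos) auto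
  ultimately have "v i0 = 0" using Lv by simp
  then have "v i = 0" if "i \<in> V" for i using eq[OF that i0] by simp
  then show False using Nv by simp
qed

text \<open>In the application \<open>G l\<close> is the form of the set enlarged by
  \<open>l\<close>, while \<open>G_sum\<close> and \<open>G_row\<close> are Euler's identity for a
  second derivative of degree \<open>c\<close>. The Lorentzian inequalities of the
  \<open>G l\<close>, added over \<open>l\<close>, give the spectral gap of
  \<open>H\<close>.\<close>

lemma lorentzian_on_trickle_down:
  fixes H :: "'a \<Rightarrow> 'a \<Rightarrow> real" and G :: "'a \<Rightarrow> 'a \<Rightarrow> 'a \<Rightarrow> real"
  assumes fin: "finite V"
    and sym: "\<And>i j. i \<in> V \<Longrightarrow> j \<in> V \<Longrightarrow> H i j = H j i"
    and nonneg: "\<And>i j. i \<in> V \<Longrightarrow> j \<in> V \<Longrightarrow> 0 \<le> H i j"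
    and pos: "\<And>i j. i \<in> V \<Longrightarrow> j \<in> V \<Longrightarrow> i \<noteq> j \<Longrightarrow> 0 < H i j"
    and row_pos: "\<And>i. i \<in> V \<Longrightarrow> 0 < (\<Sum>j\<in>V. H i j)"
    and c: "0 < c"
    and G_sum: "\<And>i j. i \<in> V \<Longrightarrow> j \<in> V \<Longrightarrow> (\<Sum>l\<in>V. G l i j) = c * H i j"
    and G_row: "\<And>l i. l \<in> V \<Longrightarrow> i \<in> V \<Longrightarrow> (\<Sum>j\<in>V. G l i j) = c * H l i"
    and G: "\<And>l. l \<in> V \<Longrightarrow> lorentzian_on V (G l)"
  shows "lorentzian_on V H"
proof -
  define D where "D i = (\<Sum>j\<in>V. H i j)" for i
  have D_row: "D i = (\<Sum>j\<in>V. H i j)" if "i \<in> V" for i by (simp add: D_def)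
  have D: "0 < D i" if "i \<in> V" for i using row_pos[OF that] by (simp add: D_def)
  have gap: "(\<Sum>i\<in>V. \<Sum>j\<in>V. v i * H i j * v j) \<le> (\<Sum>i\<in>V. (\<Sum>j\<in>V. H i j * v j)\<^sup>2 / D i)" for v
  proof -
    \<comment> \<open>By \<open>G_row\<close> the total of \<open>G l\<close> is
      \<open>c * D l\<close> and its pairing of \<open>v\<close> with the ones vector is
      \<open>c\<close> times the entry of \<open>H v\<close> at \<open>l\<close>.\<close>
    have *: "(\<Sum>i\<in>V. \<Sum>j\<in>V. v i * G l i j * v j) \<le> c * ((\<Sum>j\<in>V. H l j * v j)\<^sup>2 / D l)" if l: "l \<in> V" for l
    proof -
      have "(\<Sum>i\<in>V. \<Sum>j\<in>V. G l i j) = c * D l"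
        using l unfolding D_def sum_distrib_left by (intro sum.cong refl G_row)
      moreover have "(\<Sum>i\<in>V. \<Sum>j\<in>V. v i * G l i j) = c * (\<Sum>j\<in>V. H l j * v j)"
        unfolding sum_distrib_left[of c] sum_distrib_left[of "v _", symmetric]
        using l by (intro sum.cong refl) (simp add: G_row mult_ac)
      ultimately have "(\<Sum>i\<in>V. \<Sum>j\<in>V. v i * G l i j * v j) * (c * D l) \<le> (c * (\<Sum>j\<in>V. H l j * v j))\<^sup>2"
        using G[OF l, unfolded lorentzian_on_def, rule_format, of v] by (simp only:)
      then have "c * ((\<Sum>i\<in>V. \<Sum>j\<in>V. v i * G l i j * v j) * D l) \<le> c * (c * (\<Sum>j\<in>V. H l j * v j)\<^sup>2)"
        by (simp add: power2_eq_square mult_ac)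
      then have "(\<Sum>i\<in>V. \<Sum>j\<in>V. v i * G l i j * v j) * D l \<le> c * (\<Sum>j\<in>V. H l j * v j)\<^sup>2"
        using c by simp
      then show ?thesis using D[OF l] by (simp add: field_simps)
    qed
    have "c * (\<Sum>i\<in>V. \<Sum>j\<in>V. v i * H i j * v j) = (\<Sum>i\<in>V. \<Sum>j\<in>V. \<Sum>l\<in>V. v i * G l i j * v j)"
    proof -
      have "c * (v i * H i j * v j) = (\<Sum>l\<in>V. v i * G l i j * v j)" if "i \<in> V" "j \<in> V" for i j
      proof -
        have "(\<Sum>l\<in>V. v i * G l i j * v j) = v i * (\<Sum>l\<in>V. G l i j) * v j"
          by (simp add: sum_distrib_left sum_distrib_right)
        then show ?thesis using that by (simp add: G_sum mult_ac)
      qed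
      then show ?thesis
        unfolding sum_distrib_left[of c] by (intro sum.cong refl)
    qed
    also have "\<dots> = (\<Sum>i\<in>V. \<Sum>l\<in>V. \<Sum>j\<in>V. v i * G l i j * v j)"
      by (intro sum.cong refl sum.swap)
    also have "\<dots> = (\<Sum>l\<in>V. \<Sum>i\<in>V. \<Sum>j\<in>V. v i * G l i j * v j)"
      by (rule sum.swap)
    also have "\<dots> \<le> (\<Sum>l\<in>V. c * ((\<Sum>j\<in>V. H l j * v j)\<^sup>2 / D l))"
      by (intro sum_mono *)
    also have "\<dots> = c * (\<Sum>l\<in>V. (\<Sum>j\<in>V. H l j * v j)\<^sup>2 / D l)"
      by (simp add: sum_distrib_left)
    finally show ?thesis using c by simp
  qed
  show ?thesis
  proof (cases "V = {}")
    case True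
    then show ?thesis by (simp add: lorentzian_on_def)
  next
    case False
    then have D_sum: "0 < (\<Sum>i\<in>V. D i)" using fin D by (intro sum_pos) auto
    show ?thesis
    proof (rule lorentzian_onI, rule sym)
      show "0 \<le> (\<Sum>i\<in>V. \<Sum>j\<in>V. H i j)" using nonneg by (intro sum_nonneg) auto
      fix v
      \<comment> \<open>The shift that makes \<open>v + t\<close> orthogonal to the ones vector in
        the inner product weighted by \<open>D\<close>.\<close>
      define t where "t = - (\<Sum>i\<in>V. D i * v i) / (\<Sum>i\<in>V. D i)"
      have "(\<Sum>i\<in>V. D i * (v i + t)) = (\<Sum>i\<in>V. D i * v i) + t * (\<Sum>i\<in>V. D i)"
        by (simp add: sum.distrib sum_distrib_left algebra_simps)
      also have "\<dots> = 0" using D_sum by (simp add: t_def)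
      finally have L: "(\<Sum>i\<in>V. D i * (v i + t)) = 0" .
      have "(\<Sum>i\<in>V. \<Sum>j\<in>V. (v i + t) * H i j * (v j + t)) \<le> 0"
        by (rule nonpos_on_complement_if_spectral_gap[where V = V and H = H and D = D])
          (fact fin sym nonneg pos D_row D gap L)+
      then show "\<exists>t. (\<Sum>i\<in>V. \<Sum>j\<in>V. (v i + t) * H i j * (v j + t)) \<le> 0" by blast
    qed
  qed
qed

section \<open>Matroid rank\<close>

lemma (in matroid) indep_finite: "indep X \<Longrightarrow> finite X"
  using finite_ground indep_subset_ground finite_subset by blast

lemma (in matroid) finite_indep_subsets: "finite {X. X \<subseteq> S \<and> indep X}"
  using finite_ground indep_subset_ground by (auto intro: finite_subset[of _ "Pow E"])

lemma (in matroid) card_le_rank: "indep X \<Longrightarrow> X \<subseteq> S \<Longrightarrow> card X \<le> matroid_rank indep S"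
  unfolding matroid_rank_def using finite_indep_subsets by (intro Max_ge) auto

lemma (in matroid) rank_attained:
  obtains X where "indep X" "X \<subseteq> S" "card X = matroid_rank indep S"
proof -
  have "matroid_rank indep S \<in> card ` {X. X \<subseteq> S \<and> indep X}"
    unfolding matroid_rank_def using finite_indep_subsets indep_empty by (intro Max_in) auto
  then show ?thesis using that by auto
qed

text \<open>Repeated augmentation from a largest independent subset of \<open>S\<close>, by
  induction on the number of missing elements.\<close>

lemma (in matroid) extend_to_rank:
  assumes "indep X" "X \<subseteq> S"
  obtains Y where "indep Y" "X \<subseteq> Y" "Y \<subseteq> S" "card Y = matroid_rank indep S"
proof -
  have "\<exists>Y. indep Y \<and> X \<subseteq> Y \<and> Y \<subseteq> S \<and> card Y = matroid_rank indep S"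
    using assms
  proof (induction "matroid_rank indep S - card X" arbitrary: X)
    case 0
    then show ?case using card_le_rank[of X S] by (intro exI[of _ X]) auto
  next
    case (Suc d)
    obtain B where B: "indep B" "B \<subseteq> S" "card B = matroid_rank indep S"
      by (rule rank_attained)
    then have "card X < card B" using Suc.hyps(2) by linarith
    then obtain y where y: "y \<in> B - X" "indep (insert y X)"
      using indep_augment[OF Suc.prems(1) B(1)] by blast
    have "d = matroid_rank indep S - card (insert y X)"
      using Suc.hyps(2) y indep_finite[OF Suc.prems(1)] by simp
    then show ?case
      using Suc.hyps(1)[of "insert y X"] y B(2) Suc.prems(2) by blast
  qed
  then show ?thesis using that by blast
qed

lemma (in matroid) rank_mono:
  assumes "S \<subseteq> T"
  shows "matroid_rank indep S \<le> matroid_rank indep T"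
  by (metis assms card_le_rank order_trans rank_attained)

text \<open>A basis \<open>I\<close> of the intersection extends to a basis \<open>J\<close> of the
  union. The parts of \<open>J\<close> in \<open>A\<close> and in \<open>B\<close> are independent,
  cover \<open>J\<close> and overlap at least in \<open>I\<close>.\<close>

lemma (in matroid) rank_submodular:
  "matroid_rank indep (A \<union> B) + matroid_rank indep (A \<inter> B)
     \<le> matroid_rank indep A + matroid_rank indep B"
proof -
  obtain I where I: "indep I" "I \<subseteq> A \<inter> B" "card I = matroid_rank indep (A \<inter> B)"
    by (rule rank_attained)
  then obtain J where J: "indep J" "I \<subseteq> J" "J \<subseteq> A \<union> B" "card J = matroid_rank indep (A \<union> B)"
    using extend_to_rank[of I "A \<union> B"] by blast
  have fin: "finite J" using J(1) by (rule indep_finite)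
  have "card J + card I \<le> card ((J \<inter> A) \<union> (J \<inter> B)) + card ((J \<inter> A) \<inter> (J \<inter> B))"
    using J I fin by (intro add_mono card_mono) auto
  also have "\<dots> = card (J \<inter> A) + card (J \<inter> B)"
    using fin by (intro card_Un_Int[symmetric]) auto
  also have "\<dots> \<le> matroid_rank indep A + matroid_rank indep B"
    using J(1) by (intro add_mono card_le_rank) (auto intro: indep_mono)
  finally show ?thesis using I J by simp
qed

lemma (in matroid) rank_insert_le: "matroid_rank indep (insert a S) \<le> matroid_rank indep S + 1"
proof -
  obtain X where X: "indep X" "X \<subseteq> insert a S" "card X = matroid_rank indep (insert a S)"
    by (rule rank_attained)
  have "card (X - {a}) \<le> matroid_rank indep S"
    using X by (intro card_le_rank) (auto intro: indep_mono)
  moreover have "card X \<le> card (X - {a}) + 1"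
    unfolding card_Diff_singleton_if by (cases "a \<in> X"; simp only: if_True if_False; arith)
  ultimately show ?thesis using X by simp
qed

lemma (in matroid) rank_insert_submodular:
  assumes "a \<noteq> b" "a \<notin> S" "b \<notin> S"
  shows "matroid_rank indep (insert a (insert b S)) + matroid_rank indep S
     \<le> matroid_rank indep (insert a S) + matroid_rank indep (insert b S)"
proof -
  have "insert a S \<union> insert b S = insert a (insert b S)" "insert a S \<inter> insert b S = S"
    using assms by auto
  then show ?thesis using rank_submodular[of "insert a S" "insert b S"] by simp
qed

section \<open>The base case: derivatives of degree two\<close>

text \<open>\<open>R\<close> is an equivalence relation on the elements related to themselves, and
  the form is the sum of the squared class sums of \<open>y\<close>. The other elements have empty
  rows and columns.\<close>

lemma sum_equiv_nonneg:
  fixes y :: "'a \<Rightarrow> real"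
  assumes fin: "finite V"
    and sym: "\<And>i j. i \<in> V \<Longrightarrow> j \<in> V \<Longrightarrow> R i j \<Longrightarrow> R j i"
    and trans: "\<And>i j k. i \<in> V \<Longrightarrow> j \<in> V \<Longrightarrow> k \<in> V \<Longrightarrow> R i j \<Longrightarrow> R j k \<Longrightarrow> R i k"
  shows "0 \<le> (\<Sum>i\<in>V. \<Sum>j\<in>V. if R i j then y i * y j else 0)"
proof -
  define f where "f i = {j \<in> V. R i j}" for i
  \<comment> \<open>\<open>f\<close> labels the classes. Elements not related to themselves all
    share the label \<open>{}\<close>, hence the extra condition \<open>R i i\<close>.\<close>
  have R_iff: "R i j \<longleftrightarrow> f i = f j \<and> R i i" if "i \<in> V" "j \<in> V" for i j
    using that sym trans unfolding f_def by blast
  define V' where "V' = {i \<in> V. R i i}"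
  have "(\<Sum>i\<in>V. \<Sum>j\<in>V. if R i j then y i * y j else 0) =
      (\<Sum>i\<in>V'. \<Sum>j\<in>V'. if f i = f j then y i * y j else 0)"
  proof -
    have "(\<Sum>j\<in>V. if R i j then y i * y j else 0) =
        (if R i i then \<Sum>j\<in>V'. if f i = f j then y i * y j else 0 else 0)" if i: "i \<in> V" for i
    proof -
      have "\<not> R i j" if "j \<in> V - V'" for j
        using i that sym[of i j] trans[of j i j] unfolding V'_def by blast
      then have "(\<Sum>j\<in>V. if R i j then y i * y j else 0) = (\<Sum>j\<in>V'. if R i j then y i * y j else 0)"
        using fin by (intro sum.mono_neutral_right) (auto simp: V'_def)
      also have "\<dots> = (\<Sum>j\<in>V'. if f i = f j \<and> R i i then y i * y j else 0)"
      proof (intro sum.cong refl)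
        fix j assume "j \<in> V'"
        then have "j \<in> V" by (simp add: V'_def)
        show "(if R i j then y i * y j else 0) = (if f i = f j \<and> R i i then y i * y j else 0)"
          by (subst R_iff[OF i \<open>j \<in> V\<close>]) (rule refl)
      qed
      finally show ?thesis by simp
    qed
    then have "(\<Sum>i\<in>V. \<Sum>j\<in>V. if R i j then y i * y j else 0) =
      (\<Sum>i\<in>V. if R i i then \<Sum>j\<in>V'. if f i = f j then y i * y j else 0 else 0)"
      by simp
    then show ?thesis by (simp only: sum.inter_filter[OF fin, symmetric] flip: V'_def)
  qed
  \<comment> \<open>Equality of labels becomes a sum over labels of products of indicators, so that
    each label contributes a square.\<close>
  also have "\<dots> = (\<Sum>i\<in>V'. \<Sum>j\<in>V'. \<Sum>c\<in>f ` V'. (if f i = c then y i else 0) * (if f j = c then y j else 0))"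
  proof (intro sum.cong refl)
    fix i j assume "i \<in> V'" "j \<in> V'"
    moreover have "finite (f ` V')" using fin by (simp add: V'_def)
    ultimately have "(\<Sum>c\<in>f ` V'. if f i = c then y i * (if f j = f i then y j else 0) else 0)
        = y i * (if f j = f i then y j else 0)"
      by simp
    moreover have "(\<Sum>c\<in>f ` V'. (if f i = c then y i else 0) * (if f j = c then y j else 0)) =
       (\<Sum>c\<in>f ` V'. if f i = c then y i * (if f j = f i then y j else 0) else 0)"
      by (intro sum.cong refl) auto
    ultimately show "(if f i = f j then y i * y j else 0) =
        (\<Sum>c\<in>f ` V'. (if f i = c then y i else 0) * (if f j = c then y j else 0))"
      by auto
  qed
  also have "\<dots> = (\<Sum>i\<in>V'. \<Sum>c\<in>f ` V'. \<Sum>j\<in>V'. (if f i = c then y i else 0) * (if f j = c then y j else 0))"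
    by (intro sum.cong refl sum.swap)
  also have "\<dots> = (\<Sum>c\<in>f ` V'. \<Sum>i\<in>V'. \<Sum>j\<in>V'. (if f i = c then y i else 0) * (if f j = c then y j else 0))"
    by (rule sum.swap)
  also have "\<dots> = (\<Sum>c\<in>f ` V'. (\<Sum>i\<in>V'. if f i = c then y i else 0)\<^sup>2)"
    by (simp only: power2_eq_square sum_product)
  also have "\<dots> \<ge> 0" by (intro sum_nonneg) simp
  finally show ?thesis .
qed

text \<open>
  Writing \<open>d i = q\<^bsup>-r(T + i)\<^esup> \<lambda>\<^sub>i\<close>, the matrix is a multiple of \<open>d d\<^sup>T\<close> times, entrywise, the all-ones
  matrix minus a positive semidefinite one: the loops of \<open>M/T\<close> contribute an identity matrix and the
  parallel classes contribute \<open>q I + (1 - q) J\<close>.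
\<close>

lemma (in matroid) lorentzian_on_rank_two:
  fixes q :: real and lam :: "'a \<Rightarrow> real"
  assumes q: "0 < q" "q \<le> 1"
    and lam: "\<And>i. i \<in> E \<Longrightarrow> 0 < lam i"
  shows "lorentzian_on (E - T) (\<lambda>i j. if i = j then 0 else
     (1 / q) ^ matroid_rank indep (insert i (insert j T)) * (lam i * lam j))"
proof -
  let ?r = "matroid_rank indep"
  let ?V = "E - T"
  define s where "s = 1 / q"
  have s: "1 \<le> s" "0 < s" using q by (auto simp: s_def)
  define H where "H i j = (if i = j then 0 else s ^ ?r (insert i (insert j T)) * (lam i * lam j))" for i j
  define d where "d i = s ^ ?r (insert i T) * lam i" for i
  \<comment> \<open>Both elements are nonloops of \<open>M/T\<close> and they are parallel there;
    \<open>R i i\<close> says that \<open>i\<close> is a nonloop.\<close>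
  define R where "R i j \<longleftrightarrow> ?r (insert i T) = ?r T + 1 \<and> ?r (insert j T) = ?r T + 1 \<and>
     ?r (insert i (insert j T)) = ?r T + 1" for i j
  define loop where "loop i \<longleftrightarrow> ?r (insert i T) = ?r T" for i
  \<comment> \<open>The diagonal of \<open>H\<close> is zero, so the subtracted matrix must have
    diagonal \<open>(d i)\<^sup>2\<close>. At a nonloop \<open>R\<close> already supplies the share
    \<open>1 - q\<close>, at a loop nothing.\<close>
  define e where "e i = (if loop i then 1 else q)" for i
  have r1: "?r (insert i T) = ?r T \<or> ?r (insert i T) = ?r T + 1" for i
    using rank_mono[of T "insert i T"] rank_insert_le[of i T] by fastforce
  have fin: "finite ?V" using finite_ground by simp
  have R_sym: "R i j \<Longrightarrow> R j i" for i j by (auto simp: R_def insert_commute)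
  \<comment> \<open>Transitivity of parallelism: submodularity over \<open>insert j T\<close> keeps
    the rank of \<open>T\<close> with all three elements at most one above that of
    \<open>T\<close>.\<close>
  have R_trans: "R i k" if "i \<in> ?V" "j \<in> ?V" "k \<in> ?V" "R i j" "R j k" for i j k
  proof (cases "i = j \<or> j = k \<or> i = k")
    case True
    then show ?thesis using that by (auto simp: R_def)
  next
    case False
    then have "?r (insert i (insert k (insert j T))) + ?r (insert j T)
       \<le> ?r (insert i (insert j T)) + ?r (insert k (insert j T))"
      using that by (intro rank_insert_submodular) auto
    then have "?r (insert i (insert k (insert j T))) \<le> ?r T + 1"
      using that by (simp add: R_def insert_commute)
    moreover have "?r (insert i (insert k T)) \<le> ?r (insert i (insert k (insert j T)))"
      by (intro rank_mono) auto
    moreover have "?r (insert i T) \<le> ?r (insert i (insert k T))"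
      by (intro rank_mono) auto
    ultimately show ?thesis using that by (simp add: R_def)
  qed
  have H_eq: "s ^ ?r T * H i j =
     d i * d j - ((if i = j then e i * (d i * d j) else 0) + (1 - q) * (if R i j then d i * d j else 0))"
    if i: "i \<in> ?V" and j: "j \<in> ?V" for i j
  proof (cases "i = j")
    case True
    have "R i i \<longleftrightarrow> \<not> loop i" using r1[of i] by (auto simp: R_def loop_def)
    then show ?thesis using True by (simp add: H_def e_def algebra_simps)
  next
    case False
    have sub: "?r (insert i (insert j T)) + ?r T \<le> ?r (insert i T) + ?r (insert j T)"
      using False i j by (intro rank_insert_submodular) auto
    have mono: "?r (insert i T) \<le> ?r (insert i (insert j T))" "?r (insert j T) \<le> ?r (insert i (insert j T))"
      by (auto intro: rank_mono)
    have dd: "d i * d j = s ^ (?r (insert i T) + ?r (insert j T)) * (lam i * lam j)"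
      by (simp add: d_def power_add)
    have HH: "s ^ ?r T * H i j = s ^ (?r T + ?r (insert i (insert j T))) * (lam i * lam j)"
      using False by (simp add: H_def power_add)
    show ?thesis
    proof (cases "R i j")
      case True
      \<comment> \<open>For a parallel pair the exponent in \<open>d i * d j\<close> is one too
        large, and the surplus factor \<open>1 / q\<close> is cancelled by \<open>q\<close>.\<close>
      then have "?r (insert i T) + ?r (insert j T) = Suc (?r T + ?r (insert i (insert j T)))"
        by (auto simp: R_def)
      then have "q * (d i * d j) = s ^ ?r T * H i j"
        using HH dd q by (simp add: s_def)
      then show ?thesis using True False by (simp add: algebra_simps)
    next
      case nR: False
      \<comment> \<open>A pair that is not parallel, or contains a loop, attains equality in
        submodularity, so the entry is exactly \<open>d i * d j\<close>.\<close>
      then have "?r T + ?r (insert i (insert j T)) = ?r (insert i T) + ?r (insert j T)"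
        using r1[of i] r1[of j] sub mono by (elim disjE) (auto simp: R_def)
      then show ?thesis using False nR HH dd by simp
    qed
  qed
  have H_sym: "H i j = H j i" for i j by (simp add: H_def insert_commute)
  have H_nonneg: "0 \<le> H i j" if "i \<in> ?V" "j \<in> ?V" for i j
    using that lam[of i] lam[of j] s by (simp add: H_def)
  have quad: "s ^ ?r T * (\<Sum>i\<in>?V. \<Sum>j\<in>?V. x i * H i j * x j) \<le> (\<Sum>i\<in>?V. d i * x i)\<^sup>2" for x
  proof -
    define y where "y i = d i * x i" for i
    have "s ^ ?r T * (\<Sum>i\<in>?V. \<Sum>j\<in>?V. x i * H i j * x j) =
       (\<Sum>i\<in>?V. \<Sum>j\<in>?V. x i * (s ^ ?r T * H i j) * x j)"
      by (simp add: sum_distrib_left mult_ac)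
    also have "\<dots> = (\<Sum>i\<in>?V. \<Sum>j\<in>?V. y i * y j -
       ((if i = j then e i * (y i)\<^sup>2 else 0) + (1 - q) * (if R i j then y i * y j else 0)))"
      by (intro sum.cong refl, subst H_eq) (auto simp: y_def algebra_simps power2_eq_square)
    also have "\<dots> = (\<Sum>i\<in>?V. y i)\<^sup>2 -
       ((\<Sum>i\<in>?V. e i * (y i)\<^sup>2) + (1 - q) * (\<Sum>i\<in>?V. \<Sum>j\<in>?V. if R i j then y i * y j else 0))"
      unfolding power2_eq_square[of "sum y _"] sum_product
      using fin by (simp add: sum_subtractf sum.distrib sum_distrib_left)
    also have "\<dots> \<le> (\<Sum>i\<in>?V. y i)\<^sup>2"
    proof -
      have "0 \<le> (\<Sum>i\<in>?V. e i * (y i)\<^sup>2)" using q by (intro sum_nonneg) (simp add: e_def)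
      moreover have "0 \<le> (1 - q) * (\<Sum>i\<in>?V. \<Sum>j\<in>?V. if R i j then y i * y j else 0)"
      proof (intro mult_nonneg_nonneg)
        show "0 \<le> (\<Sum>i\<in>?V. \<Sum>j\<in>?V. if R i j then y i * y j else 0)"
          using fin R_sym R_trans by (rule sum_equiv_nonneg)
      qed (use q in simp)
      ultimately show ?thesis by linarith
    qed
    finally show ?thesis by (simp add: y_def)
  qed
  have "lorentzian_on ?V H"
  proof (rule lorentzian_onI, rule H_sym)
    show "0 \<le> (\<Sum>i\<in>?V. \<Sum>j\<in>?V. H i j)" using H_nonneg by (intro sum_nonneg) auto
    fix v
    \<comment> \<open>Chosen so that the linear form on the right of \<open>quad\<close> vanishes at
      \<open>v + t\<close>.\<close>
    define t where "t = - (\<Sum>i\<in>?V. d i * v i) / (\<Sum>i\<in>?V. d i)"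
    have "(\<Sum>i\<in>?V. d i * (v i + t)) = 0"
    proof (cases "?V = {}")
      case False
      then have "0 < (\<Sum>i\<in>?V. d i)" using fin lam s by (intro sum_pos) (auto simp: d_def)
      moreover have "(\<Sum>i\<in>?V. d i * (v i + t)) = (\<Sum>i\<in>?V. d i * v i) + t * (\<Sum>i\<in>?V. d i)"
        by (simp add: sum.distrib sum_distrib_left algebra_simps)
      ultimately show ?thesis by (simp add: t_def)
    qed (simp only: sum.empty)
    then have "s ^ ?r T * (\<Sum>i\<in>?V. \<Sum>j\<in>?V. (v i + t) * H i j * (v j + t)) \<le> 0"
      using quad[of "\<lambda>i. v i + t"] by simp
    then have "(\<Sum>i\<in>?V. \<Sum>j\<in>?V. (v i + t) * H i j * (v j + t)) \<le> 0"
      using mult_le_cancel_left_pos[OF zero_less_power[OF s(2)], of "?r T" _ 0] by (simp only: mult_zero_right)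
    then show "\<exists>t. (\<Sum>i\<in>?V. \<Sum>j\<in>?V. (v i + t) * H i j * (v j + t)) \<le> 0" by blast
  qed
  then show ?thesis unfolding H_def[abs_def] s_def .
qed

section \<open>Sums over supersets\<close>

definition superset_sum :: "'a set \<Rightarrow> nat \<Rightarrow> ('a set \<Rightarrow> real) \<Rightarrow> 'a set \<Rightarrow> real" where
  "superset_sum A k W T = (\<Sum>S\<in>{S. T \<subseteq> S \<and> S \<subseteq> A \<and> card S = k}. W S)"

text \<open>The diagonal is zero because a multiaffine polynomial has no second derivative in a
  single variable.\<close>

definition hess_at :: "('a set \<Rightarrow> real) \<Rightarrow> 'a set \<Rightarrow> 'a \<Rightarrow> 'a \<Rightarrow> real" where
  "hess_at h T i j = (if i = j then 0 else h (insert i (insert j T)))"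

text \<open>Euler's identity in combinatorial form: double counting, as each \<open>k\<close>-set
  \<open>S\<close> above \<open>T\<close> occurs once for every element of
  \<open>S - T\<close>.\<close>

lemma sum_superset_sum_insert:
  assumes fin: "finite A" and T: "T \<subseteq> A" "card T \<le> k"
  shows "(\<Sum>i\<in>A - T. superset_sum A k W (insert i T)) = real (k - card T) * superset_sum A k W T"
proof -
  let ?F = "{S. T \<subseteq> S \<and> S \<subseteq> A \<and> card S = k}"
  have finF: "finite ?F" using fin by (auto intro: finite_subset[of _ "Pow A"])
  have "superset_sum A k W (insert i T) = (\<Sum>S\<in>?F. if i \<in> S then W S else 0)" for i
  proof -
    have eq: "{S. insert i T \<subseteq> S \<and> S \<subseteq> A \<and> card S = k} = {S \<in> ?F. i \<in> S}" by auto
    show ?thesis unfolding superset_sum_def eq by (rule sum.inter_filter[OF finF])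
  qed
  then have "(\<Sum>i\<in>A - T. superset_sum A k W (insert i T)) =
      (\<Sum>i\<in>A - T. \<Sum>S\<in>?F. if i \<in> S then W S else 0)" by simp
  also have "\<dots> = (\<Sum>S\<in>?F. \<Sum>i\<in>A - T. if i \<in> S then W S else 0)" by (rule sum.swap)
  also have "\<dots> = (\<Sum>S\<in>?F. real (k - card T) * W S)"
  proof (intro sum.cong refl)
    fix S assume S: "S \<in> ?F"
    then have "{i \<in> A - T. i \<in> S} = S - T" by auto
    moreover have "card (S - T) = k - card T"
      using S T fin by (simp add: card_Diff_subset finite_subset)
    moreover have "(\<Sum>i\<in>A - T. if i \<in> S then W S else 0) = (\<Sum>i\<in>{i \<in> A - T. i \<in> S}. W S)"
      using fin by (intro sum.inter_filter[symmetric]) auto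
    ultimately show "(\<Sum>i\<in>A - T. if i \<in> S then W S else 0) = real (k - card T) * W S" by simp
  qed
  finally show ?thesis by (simp add: superset_sum_def sum_distrib_left)
qed

lemma superset_sum_nonneg:
  assumes "\<And>S. S \<subseteq> A \<Longrightarrow> 0 < W S"
  shows "0 \<le> superset_sum A k W T"
  unfolding superset_sum_def using assms by (intro sum_nonneg) (auto simp: less_imp_le)

lemma superset_sum_pos:
  assumes fin: "finite A" and W: "\<And>S. S \<subseteq> A \<Longrightarrow> 0 < W S"
    and T: "T \<subseteq> A" "card T \<le> k" and k: "k \<le> card A"
  shows "0 < superset_sum A k W T"
proof -
  obtain S where S: "T \<subseteq> S" "S \<subseteq> A" "card S = k"
    using exists_subset_between[OF T(2) k T(1) fin] by blast
  have "finite {S. T \<subseteq> S \<and> S \<subseteq> A \<and> card S = k}"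
    using fin by (auto intro: finite_subset[of _ "Pow A"])
  with S W show ?thesis
    unfolding superset_sum_def by (intro sum_pos) auto
qed

lemma superset_sum_eq_0:
  assumes "finite A" "T \<subseteq> A" "k < card T \<or> card A < k"
  shows "superset_sum A k W T = 0"
proof -
  have "{S. T \<subseteq> S \<and> S \<subseteq> A \<and> card S = k} = {}"
  proof safe
    fix S assume S: "T \<subseteq> S" "S \<subseteq> A" "k = card S"
    then have "card T \<le> card S" "card S \<le> card A"
      using assms(1) by (auto intro: card_mono finite_subset)
    then show "S \<in> {}" using assms(3) S by linarith
  qed
  then show ?thesis by (simp only: superset_sum_def sum.empty)
qed

lemma superset_sum_top:
  assumes "finite A" "T \<subseteq> A" "card T = k"
  shows "superset_sum A k W T = W T"
proof -
  have "S = T" if "T \<subseteq> S" "S \<subseteq> A" "card S = k" for S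
    using card_subset_eq[of S T] finite_subset[OF that(2) assms(1)] that assms(3) by simp
  then have "{S. T \<subseteq> S \<and> S \<subseteq> A \<and> card S = k} = {T}"
    using assms by blast
  then show ?thesis by (simp add: superset_sum_def)
qed

section \<open>Descending induction on the set of derivatives\<close>

lemma lorentzian_on_scale:
  assumes "lorentzian_on A H"
  shows "lorentzian_on A (\<lambda>i j. c * H i j)"
  unfolding lorentzian_on_def
proof
  fix v
  have "(\<Sum>i\<in>A. \<Sum>j\<in>A. v i * (c * H i j) * v j) = c * (\<Sum>i\<in>A. \<Sum>j\<in>A. v i * H i j * v j)"
    "(\<Sum>i\<in>A. \<Sum>j\<in>A. v i * (c * H i j)) = c * (\<Sum>i\<in>A. \<Sum>j\<in>A. v i * H i j)"
    "(\<Sum>i\<in>A. \<Sum>j\<in>A. c * H i j) = c * (\<Sum>i\<in>A. \<Sum>j\<in>A. H i j)"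
    by (simp_all add: sum_distrib_left mult_ac)
  moreover have "c\<^sup>2 * ((\<Sum>i\<in>A. \<Sum>j\<in>A. v i * H i j * v j) * (\<Sum>i\<in>A. \<Sum>j\<in>A. H i j))
      \<le> c\<^sup>2 * (\<Sum>i\<in>A. \<Sum>j\<in>A. v i * H i j)\<^sup>2"
    using assms unfolding lorentzian_on_def by (intro mult_left_mono) auto
  ultimately show "(\<Sum>i\<in>A. \<Sum>j\<in>A. v i * (c * H i j) * v j) * (\<Sum>i\<in>A. \<Sum>j\<in>A. c * H i j)
      \<le> (\<Sum>i\<in>A. \<Sum>j\<in>A. v i * (c * H i j))\<^sup>2"
    by (simp add: power2_eq_square mult_ac)
qed

lemma lorentzian_on_cong:
  assumes "\<And>i j. i \<in> A \<Longrightarrow> j \<in> A \<Longrightarrow> H i j = H' i j"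
  shows "lorentzian_on A H \<longleftrightarrow> lorentzian_on A H'"
  unfolding lorentzian_on_def using assms by (simp cong: sum.cong)

text \<open>The induction runs on the degree left above two. Each step feeds the forms of the sets
  \<open>insert l T\<close> into \<open>lorentzian_on_trickle_down\<close>.\<close>

lemma lorentzian_on_hess_induct:
  fixes W :: "'a set \<Rightarrow> real"
  assumes fin: "finite A" and W: "\<And>S. S \<subseteq> A \<Longrightarrow> 0 < W S"
    and base: "\<And>T. T \<subseteq> A \<Longrightarrow> card T + 2 = k \<Longrightarrow> lorentzian_on (A - T) (hess_at W T)"
    and T: "T \<subseteq> A" "card T + 2 \<le> k"
  shows "lorentzian_on (A - T) (hess_at (superset_sum A k W) T)"
  using T
proof (induction "k - card T - 2" arbitrary: T)
  case 0
  have "hess_at (superset_sum A k W) T i j = hess_at W T i j" if "i \<in> A - T" "j \<in> A - T" for i j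
  proof (cases "i = j")
    case False
    have "card (insert i (insert j T)) = k"
      using 0 False that fin finite_subset[OF \<open>T \<subseteq> A\<close> fin] by simp
    then show ?thesis
      using superset_sum_top[OF fin, of "insert i (insert j T)" k W] that 0 by (simp add: hess_at_def)
  qed (simp add: hess_at_def)
  then show ?case
    using base[of T] 0 lorentzian_on_cong[of "A - T" "hess_at (superset_sum A k W) T"] by simp
next
  case (Suc d)
  let ?V = "A - T"
  let ?h = "superset_sum A k W"
  have finT: "finite T" using Suc.prems fin finite_subset by blast
  have d: "card T + 3 + d = k" using Suc.hyps(2) by linarith
  show ?case
  proof (cases "k \<le> card A")
    case False
    \<comment> \<open>Without any \<open>k\<close>-set in \<open>A\<close> all sums are empty. This
      case is split off because trickling down requires positive entries.\<close>
    have "hess_at ?h T i j = 0" if "i \<in> ?V" "j \<in> ?V" for i j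
      using False that Suc.prems superset_sum_eq_0[OF fin, of "insert i (insert j T)" k W]
      by (auto simp: hess_at_def)
    then show ?thesis by (simp add: lorentzian_on_def)
  next
    case k: True
    \<comment> \<open>\<open>hess_at\<close> of \<open>insert l T\<close> does not vanish at the
      index \<open>l\<close>, which is outside its domain \<open>A - insert l T\<close>; row and
      column \<open>l\<close> are therefore set to zero.\<close>
    define G where "G l i j = (if l = i \<or> l = j then 0 else hess_at ?h (insert l T) i j)" for l i j
    have pos: "0 < hess_at ?h T i j" if "i \<in> ?V" "j \<in> ?V" "i \<noteq> j" for i j
    proof -
      have "card (insert i (insert j T)) \<le> k" using that finT d by simp
      then have "0 < ?h (insert i (insert j T))"
        using that Suc.prems by (intro superset_sum_pos[OF fin W _ _ k]) auto
      then show ?thesis using that by (simp add: hess_at_def)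
    qed
    have nonneg: "0 \<le> hess_at ?h T i j" for i j
      using superset_sum_nonneg[of A W k] W by (simp add: hess_at_def)
    show ?thesis
    proof (rule lorentzian_on_trickle_down[where G = G and c = "real (Suc d)"])
      show "finite ?V" using fin by simp
      show "hess_at ?h T i j = hess_at ?h T j i" for i j by (simp add: hess_at_def insert_commute)
      show "0 \<le> hess_at ?h T i j" for i j by (rule nonneg)
      show "0 < hess_at ?h T i j" if "i \<in> ?V" "j \<in> ?V" "i \<noteq> j" for i j using pos that .
      show "0 < (\<Sum>j\<in>?V. hess_at ?h T i j)" if i: "i \<in> ?V" for i
      proof -
        \<comment> \<open>Since \<open>k \<le> card A\<close>, at least \<open>d + 2\<close> further
          elements remain, and any of them gives a positive entry in row \<open>i\<close>.\<close>
        have "card (?V - {i}) = card A - card T - 1"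
          using i Suc.prems finT fin by (simp add: card_Diff_subset)
        then have "card (?V - {i}) \<noteq> 0" using k d by linarith
        then have "?V - {i} \<noteq> {}" by force
        then obtain j where "j \<in> ?V" "j \<noteq> i" by blast
        then show ?thesis
          using fin i pos nonneg by (intro sum_pos2[of _ j]) auto
      qed
      show "0 < real (Suc d)" by simp
      \<comment> \<open>Euler's identity at \<open>T\<close> with \<open>i\<close> and
        \<open>j\<close> added; \<open>Suc d\<close> is the number of elements still to be chosen.
        The row sums below follow in the same way, since third derivatives are symmetric in
        \<open>l\<close>, \<open>i\<close> and \<open>j\<close>.\<close>
      show "(\<Sum>l\<in>?V. G l i j) = real (Suc d) * hess_at ?h T i j" if ij: "i \<in> ?V" "j \<in> ?V" for i j
      proof (cases "i = j")
        case False
        let ?T = "insert i (insert j T)"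
        have "(\<Sum>l\<in>?V. G l i j) = (\<Sum>l\<in>A - ?T. ?h (insert l ?T))"
          using fin False
          by (intro sum.mono_neutral_cong_right) (auto simp: G_def hess_at_def insert_commute)
        also have "\<dots> = real (k - card ?T) * ?h ?T"
          using ij False d finT Suc.prems by (intro sum_superset_sum_insert[OF fin]) auto
        also have "k - card ?T = Suc d" using ij False finT d by simp
        finally show ?thesis using False by (simp add: hess_at_def)
      qed (auto simp: G_def hess_at_def intro!: sum.neutral)
      show "(\<Sum>j\<in>?V. G l i j) = real (Suc d) * hess_at ?h T l i" if li: "l \<in> ?V" "i \<in> ?V" for l i
      proof (cases "l = i")
        case False
        let ?T = "insert l (insert i T)"
        have "(\<Sum>j\<in>?V. G l i j) = (\<Sum>j\<in>A - ?T. ?h (insert j ?T))"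
          using fin False
          by (intro sum.mono_neutral_cong_right) (auto simp: G_def hess_at_def insert_commute)
        also have "\<dots> = real (k - card ?T) * ?h ?T"
          using li False d finT Suc.prems by (intro sum_superset_sum_insert[OF fin]) auto
        also have "k - card ?T = Suc d" using li False finT d by simp
        finally show ?thesis using False by (simp add: hess_at_def)
      qed (auto simp: G_def hess_at_def intro!: sum.neutral)
      show "lorentzian_on ?V (G l)" if l: "l \<in> ?V" for l
      proof -
        have "lorentzian_on (A - insert l T) (hess_at ?h (insert l T))"
          using l finT d Suc.prems by (intro Suc.hyps(1)) auto
        then have "lorentzian_on (A - insert l T) (G l)"
          by (subst lorentzian_on_cong[where H' = "hess_at ?h (insert l T)"]) (auto simp: G_def)
        then show ?thesis
          using fin by (subst lorentzian_on_superset[where V = "A - insert l T"]) (auto simp: G_def)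
      qed
    qed
  qed
qed

text \<open>With \<open>m = k - card T\<close>, Euler's identity turns the total of the Hessian into
  \<open>m * (m - 1) * h T\<close> and its pairing with the ones vector into \<open>(m - 1)\<close>
  times the linear form. The Lorentzian inequality thus bounds \<open>m * h T * Q\<close> by
  \<open>(m - 1)\<close> times the square, a little more than is claimed. For \<open>m < 2\<close>
  the Hessian is zero.\<close>

lemma log_concavity_of_lorentzian_hess:
  fixes W :: "'a set \<Rightarrow> real"
  assumes fin: "finite A" and T: "T \<subseteq> A"
    and lor: "card T + 2 \<le> k \<Longrightarrow> lorentzian_on (A - T) (hess_at (superset_sum A k W) T)"
  shows "superset_sum A k W T * (\<Sum>i\<in>A - T. \<Sum>j\<in>A - T. v i * hess_at (superset_sum A k W) T i j * v j)
      \<le> (\<Sum>i\<in>A - T. v i * superset_sum A k W (insert i T))\<^sup>2"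
proof -
  let ?V = "A - T"
  let ?h = "superset_sum A k W"
  have finT: "finite T" using T fin finite_subset by blast
  let ?Q = "\<Sum>i\<in>?V. \<Sum>j\<in>?V. v i * hess_at ?h T i j * v j"
  let ?L = "\<Sum>i\<in>?V. v i * ?h (insert i T)"
  show ?thesis
  proof (cases "card T + 2 \<le> k")
    case False
    have "hess_at ?h T i j = 0" if "i \<in> ?V" "j \<in> ?V" for i j
      using False that T finT superset_sum_eq_0[OF fin, of "insert i (insert j T)" k W]
      by (auto simp: hess_at_def)
    then show ?thesis by simp
  next
    case True
    define m where "m = real (k - card T)"
    have m: "2 \<le> m" using True by (simp add: m_def)
    have row: "(\<Sum>j\<in>?V. hess_at ?h T i j) = (m - 1) * ?h (insert i T)" if i: "i \<in> ?V" for i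
    proof -
      have "(\<Sum>j\<in>?V. hess_at ?h T i j) = (\<Sum>j\<in>A - insert i T. ?h (insert j (insert i T)))"
        using fin by (intro sum.mono_neutral_cong_right) (auto simp: hess_at_def insert_commute)
      also have "\<dots> = real (k - card (insert i T)) * ?h (insert i T)"
        using i True finT T by (intro sum_superset_sum_insert[OF fin]) auto
      also have "real (k - card (insert i T)) = m - 1"
        using i True finT by (simp add: m_def of_nat_diff)
      finally show ?thesis .
    qed
    have "(\<Sum>i\<in>?V. \<Sum>j\<in>?V. hess_at ?h T i j) = (m - 1) * (\<Sum>i\<in>?V. ?h (insert i T))"
      unfolding sum_distrib_left by (intro sum.cong refl row)
    also have "\<dots> = (m - 1) * (m * ?h T)"
      using sum_superset_sum_insert[OF fin T, of k W] True by (simp add: m_def)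
    finally have tot: "(\<Sum>i\<in>?V. \<Sum>j\<in>?V. hess_at ?h T i j) = (m - 1) * (m * ?h T)" .
    have lin: "(\<Sum>i\<in>?V. \<Sum>j\<in>?V. v i * hess_at ?h T i j) = (m - 1) * ?L"
      unfolding sum_distrib_left[of "m - 1"] sum_distrib_left[of "v _", symmetric]
      by (intro sum.cong refl) (simp add: row mult_ac)
    have "?Q * ((m - 1) * (m * ?h T)) \<le> ((m - 1) * ?L)\<^sup>2"
      using lor[OF True, unfolded lorentzian_on_def, rule_format, of v] tot lin by (simp only:)
    then have "(m - 1) * (m * (?h T * ?Q)) \<le> (m - 1) * ((m - 1) * ?L\<^sup>2)"
      by (simp only: power2_eq_square mult_ac)
    then have "m * (?h T * ?Q) \<le> (m - 1) * ?L\<^sup>2" using m by simp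
    also have "\<dots> \<le> m * ?L\<^sup>2" by (intro mult_right_mono) auto
    finally show ?thesis using m by simp
  qed
qed

section \<open>Multiaffine polynomials\<close>

definition monom_of_set :: "nat set \<Rightarrow> (nat \<Rightarrow>\<^sub>0 nat)" where
  "monom_of_set U = (\<Sum>i\<in>U. Poly_Mapping.single i 1)"

definition multiaffine :: "nat set \<Rightarrow> (nat set \<Rightarrow> real) \<Rightarrow> real_mpoly" where
  "multiaffine A c = (\<Sum>U\<in>Pow A. Poly_Mapping.single (monom_of_set U) (c U))"

definition multiaffine_eval :: "nat set \<Rightarrow> (nat set \<Rightarrow> real) \<Rightarrow> (nat \<Rightarrow> real) \<Rightarrow> real" where
  "multiaffine_eval A c x = (\<Sum>U\<in>Pow A. c U * (\<Prod>i\<in>U. x i))"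

definition coeff_deriv :: "nat \<Rightarrow> (nat set \<Rightarrow> real) \<Rightarrow> nat set \<Rightarrow> real" where
  "coeff_deriv i c U = (if i \<in> U then 0 else c (insert i U))"

section \<open>Coefficients and formal derivatives\<close>

lemma lookup_monom_of_set:
  "finite U \<Longrightarrow> Poly_Mapping.lookup (monom_of_set U) i = (if i \<in> U then 1 else 0)"
  by (simp add: monom_of_set_def lookup_sum lookup_single when_def)

lemma monom_of_set_eq_iff:
  assumes "finite U" "finite V"
  shows "monom_of_set U = monom_of_set V \<longleftrightarrow> U = V"
proof
  assume eq: "monom_of_set U = monom_of_set V"
  show "U = V"
  proof (rule set_eqI)
    fix i
    have "Poly_Mapping.lookup (monom_of_set U) i = Poly_Mapping.lookup (monom_of_set V) i"
      by (simp only: eq)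
    then show "i \<in> U \<longleftrightarrow> i \<in> V"
      unfolding assms[THEN lookup_monom_of_set] by (simp split: if_splits)
  qed
qed simp

lemma keys_monom_of_set: "finite U \<Longrightarrow> Poly_Mapping.keys (monom_of_set U) = U"
  by (auto simp: in_keys_iff lookup_monom_of_set split: if_splits)

lemma lookup_multiaffine:
  assumes "finite A" "U \<subseteq> A"
  shows "Poly_Mapping.lookup (multiaffine A c) (monom_of_set U) = c U"
proof -
  have "Poly_Mapping.lookup (multiaffine A c) (monom_of_set U) = (\<Sum>V\<in>Pow A. if V = U then c V else 0)"
    unfolding multiaffine_def lookup_sum
  proof (intro sum.cong refl)
    fix V assume "V \<in> Pow A"
    then have "finite V" "finite U" using assms finite_subset by auto
    then show "Poly_Mapping.lookup (Poly_Mapping.single (monom_of_set V) (c V)) (monom_of_set U) =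
        (if V = U then c V else 0)"
      by (simp add: lookup_single when_def monom_of_set_eq_iff)
  qed
  then show ?thesis using assms by simp
qed

lemma lookup_multiaffine_other:
  assumes "\<And>U. U \<subseteq> A \<Longrightarrow> m \<noteq> monom_of_set U"
  shows "Poly_Mapping.lookup (multiaffine A c) m = 0"
  unfolding multiaffine_def lookup_sum
  using assms by (intro sum.neutral) (auto simp: lookup_single when_def)

lemma lookup_mp_deriv:
  "Poly_Mapping.lookup (mp_deriv i p) m =
     (real (Poly_Mapping.lookup m i) + 1) * Poly_Mapping.lookup p (m + Poly_Mapping.single i 1)"
proof -
  let ?m = "m + Poly_Mapping.single i 1"
  \<comment> \<open>Truncated subtraction is reversible only at a positive exponent; at exponent
    zero the coefficient in \<open>mp_deriv\<close> vanishes.\<close>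
  have iff: "m' - Poly_Mapping.single i 1 = m \<longleftrightarrow> m' = ?m" if "0 < Poly_Mapping.lookup m' i" for m'
  proof
    assume "m' - Poly_Mapping.single i 1 = m"
    then show "m' = ?m"
      using that by (intro poly_mapping_eqI) (auto simp: lookup_add lookup_minus lookup_single when_def)
  qed auto
  have "Poly_Mapping.lookup (mp_deriv i p) m =
      (\<Sum>m'\<in>Poly_Mapping.keys p.
         if m' = ?m then real (Poly_Mapping.lookup m' i) * Poly_Mapping.lookup p m' else 0)"
    unfolding mp_deriv_def lookup_sum
  proof (intro sum.cong refl)
    fix m'
    show "Poly_Mapping.lookup (Poly_Mapping.single (m' - Poly_Mapping.single i 1)
          (real (Poly_Mapping.lookup m' i) * Poly_Mapping.lookup p m')) m =
        (if m' = ?m then real (Poly_Mapping.lookup m' i) * Poly_Mapping.lookup p m' else 0)"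
      using iff[of m'] by (cases "Poly_Mapping.lookup m' i = 0") (auto simp: lookup_single when_def)
  qed
  also have "\<dots> = real (Poly_Mapping.lookup ?m i) * Poly_Mapping.lookup p ?m"
    by (simp add: in_keys_iff)
  finally show ?thesis by (simp add: lookup_add)
qed

lemma monom_of_set_insert:
  assumes "finite U" "i \<notin> U"
  shows "monom_of_set (insert i U) = monom_of_set U + Poly_Mapping.single i 1"
  using assms by (simp add: monom_of_set_def add.commute)

text \<open>Coefficients are compared at \<open>m\<close>. If \<open>m\<close> already contains
  \<open>i\<close>, or is not squarefree, then \<open>m + ?e\<close> is not squarefree either and
  both sides are zero.\<close>

lemma mp_deriv_multiaffine:
  assumes fin: "finite A" and i: "i \<in> A"
  shows "mp_deriv i (multiaffine A c) = multiaffine A (coeff_deriv i c)"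
proof (rule poly_mapping_eqI)
  fix m
  let ?e = "Poly_Mapping.single i (1 :: nat)"
  show "Poly_Mapping.lookup (mp_deriv i (multiaffine A c)) m =
      Poly_Mapping.lookup (multiaffine A (coeff_deriv i c)) m"
  proof (cases "\<exists>U\<subseteq>A. m = monom_of_set U")
    case True
    then obtain U where U: "U \<subseteq> A" "m = monom_of_set U" by blast
    have finU: "finite U" using U fin finite_subset by blast
    show ?thesis
    proof (cases "i \<in> U")
      case True
      have "Poly_Mapping.lookup (multiaffine A c) (m + ?e) = 0"
      proof (rule lookup_multiaffine_other)
        fix V assume "V \<subseteq> A"
        then have "finite V" using fin finite_subset by blast
        then have "Poly_Mapping.lookup (monom_of_set V) i \<le> 1"
          by (simp add: lookup_monom_of_set)
        moreover have "Poly_Mapping.lookup (m + ?e) i = 2"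
          using True finU U by (simp add: lookup_add lookup_monom_of_set)
        ultimately show "m + ?e \<noteq> monom_of_set V" by auto
      qed
      then show ?thesis
        using True U fin by (simp add: lookup_mp_deriv lookup_multiaffine coeff_deriv_def)
    next
      case False
      have "m + ?e = monom_of_set (insert i U)"
        using monom_of_set_insert[OF finU False] U by simp
      then show ?thesis
        using False U fin i finU
        by (simp add: lookup_mp_deriv lookup_multiaffine coeff_deriv_def lookup_monom_of_set)
    qed
  next
    case False
    have "Poly_Mapping.lookup (multiaffine A c) (m + ?e) = 0"
    proof (rule lookup_multiaffine_other, rule notI)
      fix V assume V: "V \<subseteq> A" "m + ?e = monom_of_set V"
      have finV: "finite V" using V fin finite_subset by blast
      have "Poly_Mapping.lookup (m + ?e) i \<ge> 1" by (simp add: lookup_add)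
      then have "i \<in> V" using V finV by (simp add: lookup_monom_of_set split: if_splits)
      then have "m + ?e = monom_of_set (V - {i}) + ?e"
        using V monom_of_set_insert[of "V - {i}" i] finV by (simp add: insert_absorb)
      then have "m = monom_of_set (V - {i})" by simp
      then show False using False V by blast
    qed
    then show ?thesis using False by (simp add: lookup_mp_deriv lookup_multiaffine_other)
  qed
qed

lemma mp_eval_multiaffine:
  assumes fin: "finite A"
  shows "mp_eval (multiaffine A c) x = multiaffine_eval A c x"
proof -
  let ?p = "multiaffine A c"
  let ?t = "\<lambda>m. Poly_Mapping.lookup ?p m *
        (\<Prod>i\<in>Poly_Mapping.keys m. x i ^ Poly_Mapping.lookup m i)"
  have inj: "inj_on monom_of_set (Pow A)"
    using fin finite_subset monom_of_set_eq_iff by (metis PowD inj_onI)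
  \<comment> \<open>Coefficients may be zero, so the sum over keys is first enlarged to all
    squarefree monomials.\<close>
  have "Poly_Mapping.keys ?p \<subseteq> monom_of_set ` Pow A"
    using lookup_multiaffine_other[of A] by (fastforce simp: in_keys_iff)
  then have "mp_eval ?p x = sum ?t (monom_of_set ` Pow A)"
    unfolding mp_eval_def using fin by (intro sum.mono_neutral_left) (auto simp: in_keys_iff)
  also have "\<dots> = (\<Sum>U\<in>Pow A. ?t (monom_of_set U))"
    using inj by (simp add: sum.reindex)
  also have "\<dots> = multiaffine_eval A c x"
    unfolding multiaffine_eval_def
  proof (intro sum.cong refl)
    fix U assume U: "U \<in> Pow A"
    then have finU: "finite U" using fin finite_subset by blast
    then have "(\<Prod>i\<in>U. x i ^ Poly_Mapping.lookup (monom_of_set U) i) = (\<Prod>i\<in>U. x i)"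
      by (intro prod.cong refl) (simp add: lookup_monom_of_set)
    then show "?t (monom_of_set U) = c U * (\<Prod>i\<in>U. x i)"
      using U fin finU by (simp add: lookup_multiaffine keys_monom_of_set)
  qed
  finally show ?thesis .
qed

section \<open>Evaluation and analytic derivatives\<close>

text \<open>The polynomial is affine in each variable, as seen by splitting the sets according to
  whether they contain \<open>i\<close>. The slope does not depend on \<open>x i\<close>, so it can
  be evaluated at \<open>x\<close> itself.\<close>

lemma multiaffine_eval_update:
  assumes fin: "finite A" and i: "i \<in> A"
  shows "multiaffine_eval A c (x(i := t)) =
     multiaffine_eval A c (x(i := 0)) + t * multiaffine_eval A (coeff_deriv i c) x"
proof -
  let ?B = "A - {i}"
  have split: "sum g (Pow A) = (\<Sum>U\<in>Pow ?B. g U) + (\<Sum>U\<in>Pow ?B. g (insert i U))"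
    for g :: "nat set \<Rightarrow> real"
  proof -
    have "Pow A = Pow ?B \<union> insert i ` Pow ?B"
      using Pow_insert[of i ?B] i by (simp add: insert_absorb)
    then have "sum g (Pow A) = sum g (Pow ?B) + sum g (insert i ` Pow ?B)"
      using fin by (simp only:) (intro sum.union_disjoint, auto)
    moreover have "inj_on (insert i) (Pow ?B)" by (auto intro!: inj_onI)
    ultimately show ?thesis by (simp add: sum.reindex)
  qed
  have upd: "(\<Prod>j\<in>U. (x(i := s)) j) = (\<Prod>j\<in>U. x j)"
    "(\<Prod>j\<in>insert i U. (x(i := s)) j) = s * (\<Prod>j\<in>U. x j)" if U: "U \<in> Pow ?B" for U s
  proof -
    have "finite U" "i \<notin> U" using U fin finite_subset by auto
    moreover from this show *: "(\<Prod>j\<in>U. (x(i := s)) j) = (\<Prod>j\<in>U. x j)"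
      by (intro prod.cong) auto
    ultimately show "(\<Prod>j\<in>insert i U. (x(i := s)) j) = s * (\<Prod>j\<in>U. x j)"
      by (subst prod.insert) auto
  qed
  have eval: "multiaffine_eval A c (x(i := s)) =
      (\<Sum>U\<in>Pow ?B. c U * (\<Prod>j\<in>U. x j)) + s * (\<Sum>U\<in>Pow ?B. c (insert i U) * (\<Prod>j\<in>U. x j))" for s
    unfolding multiaffine_eval_def split sum_distrib_left
    by (intro arg_cong2[of _ _ _ _ "(+)"] sum.cong refl) (simp_all only: upd mult_ac)
  have "multiaffine_eval A (coeff_deriv i c) x = (\<Sum>U\<in>Pow ?B. c (insert i U) * (\<Prod>j\<in>U. x j))"
    unfolding multiaffine_eval_def split
    by (simp add: coeff_deriv_def) (intro sum.cong refl, auto)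
  then show ?thesis by (simp add: eval)
qed

lemma multiaffine_eval_has_derivative:
  assumes "finite A" "i \<in> A"
  shows "((\<lambda>t. multiaffine_eval A c (x(i := t))) has_real_derivative
     multiaffine_eval A (coeff_deriv i c) x) (at s)"
  by (subst multiaffine_eval_update[OF assms, of c x]) (auto intro!: derivative_eq_intros)

lemma multiaffine_eval_pos:
  assumes "finite A" "\<And>U. U \<subseteq> A \<Longrightarrow> 0 \<le> c U" "U \<subseteq> A" "0 < c U" "\<And>i. 0 < x i"
  shows "0 < multiaffine_eval A c x"
proof -
  have "0 < (\<Prod>i\<in>V. x i)" for V using assms(5) by (intro prod_pos) auto
  then show ?thesis
    unfolding multiaffine_eval_def using assms(1-4)
    by (intro sum_pos2[of _ U]) (auto simp: less_imp_le)
qed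

lemma hessian_ln_multiaffine:
  assumes fin: "finite A" and c: "\<And>U. U \<subseteq> A \<Longrightarrow> 0 \<le> c U" "U \<subseteq> A" "0 < c U"
    and ij: "i \<in> A" "j \<in> A" and x: "\<And>i. 0 < x i"
  shows "hessian (\<lambda>x. ln (multiaffine_eval A c x)) x i j =
     (multiaffine_eval A (coeff_deriv i (coeff_deriv j c)) x * multiaffine_eval A c x
      - multiaffine_eval A (coeff_deriv j c) x * multiaffine_eval A (coeff_deriv i c) x)
      / (multiaffine_eval A c x)\<^sup>2"
proof -
  let ?F = "multiaffine_eval A c"
  let ?Fj = "multiaffine_eval A (coeff_deriv j c)"
  let ?Fi = "multiaffine_eval A (coeff_deriv i c)"
  let ?Fij = "multiaffine_eval A (coeff_deriv i (coeff_deriv j c))"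
  have pos: "0 < ?F y" if "\<And>i. 0 < y i" for y
    using multiaffine_eval_pos[where A = A and c = c and U = U and x = y] fin c that by blast
  have grad: "partial_deriv j (\<lambda>x. ln (?F x)) y = ?Fj y / ?F y" if y: "\<And>i. 0 < y i" for y
    unfolding partial_deriv_def
  proof (rule DERIV_imp_deriv)
    show "((\<lambda>t. ln (?F (y(j := t)))) has_real_derivative ?Fj y / ?F y) (at (y j))"
      using pos[OF y]
      by (auto intro!: derivative_eq_intros multiaffine_eval_has_derivative[OF fin ij(2)] simp: divide_inverse)
  qed
  \<comment> \<open>The outer derivative depends on the gradient near \<open>x i\<close>; its
    formula holds as long as the moved coordinate stays positive.\<close>
  have "\<forall>\<^sub>F t in nhds (x i). t \<in> {0<..}"
    using x[of i] by (intro eventually_nhds_in_open) auto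
  then have "\<forall>\<^sub>F t in nhds (x i). partial_deriv j (\<lambda>x. ln (?F x)) (x(i := t))
      = ?Fj (x(i := t)) / ?F (x(i := t))"
    by eventually_elim (rule grad, use x in auto)
  then have "hessian (\<lambda>x. ln (?F x)) x i j = deriv (\<lambda>t. ?Fj (x(i := t)) / ?F (x(i := t))) (x i)"
    unfolding hessian_def partial_deriv_def[of i] by (intro deriv_cong_ev refl)
  also have "\<dots> = (?Fij x * ?F x - ?Fj x * ?Fi x) / (?F x)\<^sup>2"
  proof (rule DERIV_imp_deriv)
    have "?F (x(i := x i)) \<noteq> 0" using pos[of x] x by simp
    then have "((\<lambda>t. ?Fj (x(i := t)) / ?F (x(i := t))) has_real_derivative
        (?Fij x * ?F (x(i := x i)) - ?Fj (x(i := x i)) * ?Fi x) / (?F (x(i := x i)) * ?F (x(i := x i)))) (at (x i))"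
      by (intro DERIV_divide multiaffine_eval_has_derivative[OF fin ij(1)])
    then show "((\<lambda>t. ?Fj (x(i := t)) / ?F (x(i := t))) has_real_derivative
        (?Fij x * ?F x - ?Fj x * ?Fi x) / (?F x)\<^sup>2) (at (x i))"
      by (simp add: power2_eq_square)
  qed
  finally show ?thesis .
qed

lemma coeff_deriv_commute: "coeff_deriv i (coeff_deriv j c) = coeff_deriv j (coeff_deriv i c)"
  by (rule ext) (auto simp: coeff_deriv_def insert_commute)

text \<open>Evaluation at the all-ones point sums the coefficients, and the Hessian of the logarithm
  of \<open>p\<close> has entries \<open>(p * p_ij - p_i * p_j) / p\<^sup>2\<close>. Negative
  semidefiniteness is therefore the inequality \<open>quad\<close>.\<close>

lemma log_concave_at_one_multiaffine:
  assumes c: "\<And>U. U \<subseteq> {1..n} \<Longrightarrow> 0 \<le> c U"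
    and quad: "\<And>v. (\<Sum>U\<in>Pow {1..n}. c U) *
        (\<Sum>i\<in>{1..n}. \<Sum>j\<in>{1..n}. v i * (\<Sum>U\<in>Pow {1..n}. coeff_deriv i (coeff_deriv j c) U) * v j)
       \<le> (\<Sum>i\<in>{1..n}. v i * (\<Sum>U\<in>Pow {1..n}. coeff_deriv i c U))\<^sup>2"
  shows "log_concave_at_one n (multiaffine {1..n} c)"
proof -
  let ?A = "{1..n}"
  let ?p = "multiaffine ?A c"
  have nonneg: "0 \<le> Poly_Mapping.lookup ?p m" for m
  proof (cases "\<exists>U\<subseteq>?A. m = monom_of_set U")
    case True
    then show ?thesis using c by (auto simp: lookup_multiaffine)
  next
    case False
    then show ?thesis by (simp add: lookup_multiaffine_other)
  qed
  show ?thesis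
  proof (cases "\<exists>U\<subseteq>?A. 0 < c U")
    case False
    then have "c U = 0" if "U \<subseteq> ?A" for U using c[OF that] that by (meson order_antisym not_le)
    then have "?p = 0" unfolding multiaffine_def by (intro sum.neutral) simp
    then show ?thesis using nonneg by (simp add: log_concave_at_one_def)
  next
    case True
    then obtain U where U: "U \<subseteq> ?A" "0 < c U" by blast
    define S where "S c = (\<Sum>U\<in>Pow ?A. c U)" for c :: "nat set \<Rightarrow> real"
    have S: "multiaffine_eval ?A c (\<lambda>_. 1) = S c" for c
      by (simp add: multiaffine_eval_def S_def)
    let ?H = "hessian (\<lambda>x. ln (mp_eval ?p x)) (\<lambda>_. 1)"
    have H: "?H i j = (S (coeff_deriv i (coeff_deriv j c)) * S c - S (coeff_deriv j c) * S (coeff_deriv i c)) / (S c)\<^sup>2"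
      if "i \<in> ?A" "j \<in> ?A" for i j
      unfolding mp_eval_multiaffine[OF finite_atLeastAtMost] S[symmetric]
      by (rule hessian_ln_multiaffine[where U = U]) (use c U that in auto)
    have "neg_semidef n ?H"
      unfolding neg_semidef_def
    proof (intro conjI ballI allI)
      fix i j assume ij: "i \<in> ?A" "j \<in> ?A"
      show "?H i j = ?H j i"
        unfolding H[OF ij] H[OF ij(2,1)] coeff_deriv_commute[of j i] by (simp only: mult.commute)
    next
      fix v :: "nat \<Rightarrow> real"
      have "(\<Sum>i\<in>?A. \<Sum>j\<in>?A. v i * ?H i j * v j) =
         (\<Sum>i\<in>?A. \<Sum>j\<in>?A. (S c * (v i * S (coeff_deriv i (coeff_deriv j c)) * v j)
            - (v i * S (coeff_deriv i c)) * (v j * S (coeff_deriv j c))) / (S c)\<^sup>2)"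
        by (intro sum.cong refl, subst H) (simp_all add: algebra_simps diff_divide_distrib)
      also have "\<dots> = (S c * (\<Sum>i\<in>?A. \<Sum>j\<in>?A. v i * S (coeff_deriv i (coeff_deriv j c)) * v j)
            - (\<Sum>i\<in>?A. v i * S (coeff_deriv i c))\<^sup>2) / (S c)\<^sup>2"
        unfolding power2_eq_square[of "sum _ _"] sum_product
        by (simp only: sum_subtractf sum_distrib_left flip: sum_divide_distrib)
      also have "\<dots> \<le> 0"
        using quad[of v] by (simp add: divide_nonpos_nonneg S_def)
      finally show "(\<Sum>i\<in>?A. \<Sum>j\<in>?A. v i * ?H i j * v j) \<le> 0" .
    qed
    then show ?thesis using nonneg by (simp add: log_concave_at_one_def)
  qed
qed

section \<open>Derivatives of the rank polynomial\<close>

text \<open>The coefficients after differentiating once in each variable of \<open>T\<close>; the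
  order is immaterial, so a set suffices.\<close>

definition coeff_derivs :: "nat set \<Rightarrow> (nat set \<Rightarrow> real) \<Rightarrow> nat set \<Rightarrow> real" where
  "coeff_derivs T c U = (if U \<inter> T = {} then c (T \<union> U) else 0)"

lemma coeff_deriv_zero: "coeff_deriv i (\<lambda>_. 0) = (\<lambda>_. 0)"
  by (rule ext) (simp add: coeff_deriv_def)

lemma coeff_deriv_coeff_derivs:
  "coeff_deriv i (coeff_derivs T c) = (if i \<in> T then (\<lambda>_. 0) else coeff_derivs (insert i T) c)"
  by (rule ext) (auto simp: coeff_deriv_def coeff_derivs_def)

text \<open>A repeated variable annihilates a multiaffine polynomial, so lists of derivatives reduce
  to sets.\<close>

lemma foldr_mp_deriv_multiaffine:
  assumes "finite A" "set is \<subseteq> A"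
  shows "foldr mp_deriv is (multiaffine A c) =
     multiaffine A (if distinct is then coeff_derivs (set is) c else (\<lambda>_. 0))"
  using assms(2)
proof (induction "is")
  case Nil
  have "coeff_derivs {} c = c" by (rule ext) (simp add: coeff_derivs_def)
  then show ?case by simp
next
  case (Cons i "is")
  then show ?case
    using assms(1) by (simp add: mp_deriv_multiaffine coeff_deriv_coeff_derivs coeff_deriv_zero)
qed

text \<open>The bijection \<open>U\<close> to \<open>T \<union> U\<close> identifies the derivative
  along \<open>T\<close>, evaluated at the all-ones point, with a sum over supersets.\<close>

lemma sum_coeff_derivs:
  assumes fin: "finite A" and T: "T \<subseteq> A"
  shows "(\<Sum>U\<in>Pow A. coeff_derivs T (\<lambda>S. if card S = k then W S else 0) U) = superset_sum A k W T"
proof -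
  let ?c = "\<lambda>S. if card S = k then W S else 0"
  have "(\<Sum>U\<in>Pow A. coeff_derivs T ?c U) = (\<Sum>U\<in>Pow (A - T). ?c (T \<union> U))"
    using fin by (intro sum.mono_neutral_cong_right) (auto simp: coeff_derivs_def)
  also have "\<dots> = (\<Sum>S\<in>{S. T \<subseteq> S \<and> S \<subseteq> A}. ?c S)"
    using T by (intro sum.reindex_bij_witness[where i = "\<lambda>S. S - T" and j = "\<lambda>U. T \<union> U"]) auto
  also have "\<dots> = (\<Sum>S\<in>{S \<in> {S. T \<subseteq> S \<and> S \<subseteq> A}. card S = k}. W S)"
    using fin by (intro sum.inter_filter[symmetric]) (auto intro: finite_subset[of _ "Pow A"])
  finally show ?thesis by (simp add: superset_sum_def conj_assoc)
qed

lemma rank_poly_eq_multiaffine: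
  "rank_poly n indep k q lam = multiaffine {1..n}
     (\<lambda>S. if card S = k then (1 / q) ^ matroid_rank indep S * (\<Prod>i\<in>S. lam i) else 0)"
proof -
  have monom: "(\<Prod>i\<in>S. mp_const (lam i) * mp_var i) = Poly_Mapping.single (monom_of_set S) (\<Prod>i\<in>S. lam i)"
    if "finite S" for S
    using that
  proof (induction S rule: finite_induct)
    case empty
    then show ?case by (simp add: monom_of_set_def)
  next
    case (insert i S)
    then show ?case
      by (simp add: monom_of_set_insert mp_const_def mp_var_def mult_single ac_simps)
  qed
  have "rank_poly n indep k q lam = (\<Sum>S\<in>{S \<in> Pow {1..n}. card S = k}. Poly_Mapping.single (monom_of_set S)
      ((1 / q) ^ matroid_rank indep S * (\<Prod>i\<in>S. lam i)))"
    unfolding rank_poly_def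
  proof (intro sum.cong)
    fix S assume "S \<in> {S \<in> Pow {1..n}. card S = k}"
    then have "finite S" using finite_subset by blast
    then show "mp_const (q powi (- int (matroid_rank indep S))) * (\<Prod>i\<in>S. mp_const (lam i) * mp_var i) =
        Poly_Mapping.single (monom_of_set S) ((1 / q) ^ matroid_rank indep S * (\<Prod>i\<in>S. lam i))"
      by (subst monom) (simp_all add: mp_const_def mult_single power_int_minus divide_inverse power_inverse)
  qed auto
  also have "\<dots> = (\<Sum>S\<in>Pow {1..n}. if card S = k then Poly_Mapping.single (monom_of_set S)
      ((1 / q) ^ matroid_rank indep S * (\<Prod>i\<in>S. lam i)) else 0)"
    by (intro sum.inter_filter) simp
  also have "\<dots> = multiaffine {1..n}
     (\<lambda>S. if card S = k then (1 / q) ^ matroid_rank indep S * (\<Prod>i\<in>S. lam i) else 0)"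
    unfolding multiaffine_def by (intro sum.cong refl) simp
  finally show ?thesis .
qed

theorem theorem1p6:
  fixes n k :: nat and indep :: "nat set \<Rightarrow> bool" and q :: real and lam :: "nat \<Rightarrow> real"
  assumes "matroid {1..n} indep"
    and "0 < q" and "q \<le> 1"
    and "\<And>i. i \<in> {1..n} \<Longrightarrow> 0 < lam i"
  shows "strongly_log_concave_at_one n (rank_poly n indep k q lam)"
proof -
  interpret matroid "{1..n}" indep by fact
  define A where "A = {1..n}"
  have fin: "finite A" by (simp add: A_def)
  define W where "W S = (1 / q) ^ matroid_rank indep S * (\<Prod>i\<in>S. lam i)" for S
  define c where "c S = (if card S = k then W S else 0)" for S
  have W_pos: "0 < W S" if "S \<subseteq> A" for S
    using that assms(2,4) unfolding W_def A_def by (intro mult_pos_pos prod_pos) auto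
  \<comment> \<open>The product of \<open>lam\<close> over \<open>T\<close> is common to all
    entries; pulling it out leaves the matrix of \<open>lorentzian_on_rank_two\<close>.\<close>
  have base: "lorentzian_on (A - T) (hess_at W T)" if T: "T \<subseteq> A" for T
  proof -
    have finT: "finite T" using T fin finite_subset by blast
    have "lorentzian_on (A - T) (\<lambda>i j. (\<Prod>i\<in>T. lam i) * (if i = j then 0 else
         (1 / q) ^ matroid_rank indep (insert i (insert j T)) * (lam i * lam j)))"
      using assms(2,3,4) T unfolding A_def by (intro lorentzian_on_scale lorentzian_on_rank_two) auto
    moreover have "hess_at W T i j = (\<Prod>i\<in>T. lam i) * (if i = j then 0 else
         (1 / q) ^ matroid_rank indep (insert i (insert j T)) * (lam i * lam j))"
      if "i \<in> A - T" "j \<in> A - T" for i j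
      using that finT by (simp add: hess_at_def W_def mult_ac)
    ultimately show ?thesis
      by (subst lorentzian_on_cong) auto
  qed
  have log_concave: "log_concave_at_one n (multiaffine A (coeff_derivs T c))" if T: "T \<subseteq> A" for T
    unfolding A_def
  proof (rule log_concave_at_one_multiaffine; fold A_def)
    show "0 \<le> coeff_derivs T c U" if "U \<subseteq> A" for U
      using W_pos[of "T \<union> U"] T that by (simp add: coeff_derivs_def c_def less_imp_le)
    fix v :: "nat \<Rightarrow> real"
    let ?h = "superset_sum A k W"
    let ?V = "A - T"
    have S: "(\<Sum>U\<in>Pow A. coeff_derivs T c U) = ?h T" if "T \<subseteq> A" for T
      unfolding c_def using sum_coeff_derivs[OF fin that] .
    have S1: "(\<Sum>U\<in>Pow A. coeff_deriv i (coeff_derivs T c) U) = (if i \<in> T then 0 else ?h (insert i T))"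
      if "i \<in> A" for i
      using that T S[of "insert i T"] by (simp add: coeff_deriv_coeff_derivs)
    have S2: "(\<Sum>U\<in>Pow A. coeff_deriv i (coeff_deriv j (coeff_derivs T c)) U) =
        (if i \<in> T \<or> j \<in> T then 0 else hess_at ?h T i j)"
      if "i \<in> A" "j \<in> A" for i j
      using that T S[of "insert i (insert j T)"]
      by (simp add: coeff_deriv_coeff_derivs coeff_deriv_zero hess_at_def)
    \<comment> \<open>Derivatives in a variable of \<open>T\<close> vanish, so the sums shrink from
      \<open>A\<close> to \<open>?V\<close>.\<close>
    have "(\<Sum>i\<in>A. \<Sum>j\<in>A. v i * (\<Sum>U\<in>Pow A. coeff_deriv i (coeff_deriv j (coeff_derivs T c)) U) * v j)
        = (\<Sum>i\<in>?V. \<Sum>j\<in>A. v i * (\<Sum>U\<in>Pow A. coeff_deriv i (coeff_deriv j (coeff_derivs T c)) U) * v j)"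
      using fin by (intro sum.mono_neutral_right) (auto simp: S2)
    also have "\<dots> = (\<Sum>i\<in>?V. \<Sum>j\<in>?V. v i * hess_at ?h T i j * v j)"
      using fin by (intro sum.cong refl sum.mono_neutral_cong_right) (auto simp: S2)
    finally have Q: "(\<Sum>i\<in>A. \<Sum>j\<in>A. v i * (\<Sum>U\<in>Pow A. coeff_deriv i (coeff_deriv j (coeff_derivs T c)) U) * v j)
        = (\<Sum>i\<in>?V. \<Sum>j\<in>?V. v i * hess_at ?h T i j * v j)" .
    have L: "(\<Sum>i\<in>A. v i * (\<Sum>U\<in>Pow A. coeff_deriv i (coeff_derivs T c) U)) = (\<Sum>i\<in>?V. v i * ?h (insert i T))"
      using fin by (intro sum.mono_neutral_cong_right) (auto simp: S1)
    show "(\<Sum>U\<in>Pow A. coeff_derivs T c U) *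
        (\<Sum>i\<in>A. \<Sum>j\<in>A. v i * (\<Sum>U\<in>Pow A. coeff_deriv i (coeff_deriv j (coeff_derivs T c)) U) * v j)
        \<le> (\<Sum>i\<in>A. v i * (\<Sum>U\<in>Pow A. coeff_deriv i (coeff_derivs T c) U))\<^sup>2"
      unfolding Q L S[OF T]
    proof (rule log_concavity_of_lorentzian_hess[OF fin T])
      assume "card T + 2 \<le> k"
      then show "lorentzian_on (A - T) (hess_at ?h T)"
        using T base by (intro lorentzian_on_hess_induct[OF fin W_pos]) auto
    qed
  qed
  have "log_concave_at_one n (foldr mp_deriv is (multiaffine A c))" if "set is \<subseteq> A" for "is"
  proof (cases "distinct is")
    case True
    then show ?thesis using log_concave[OF that] by (simp add: foldr_mp_deriv_multiaffine[OF fin that])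
  next
    case False
    have "multiaffine A (\<lambda>_. 0) = 0" by (simp add: multiaffine_def)
    then show ?thesis
      using False by (simp add: foldr_mp_deriv_multiaffine[OF fin that] log_concave_at_one_def)
  qed
  moreover have "rank_poly n indep k q lam = multiaffine A c"
    unfolding rank_poly_eq_multiaffine A_def c_def[abs_def] W_def[abs_def] ..
  ultimately show ?thesis by (simp add: strongly_log_concave_at_one_def A_def)
qed

end
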